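(* Fix infinite positive vectors $\Psi_i=(\gamma_{i1},\gamma_{i2},\dots)$, $1\le i\le m$, with $\sum_{j\ge1}\gamma_{ij}<\infty$ for each $i$ and $\sup\{\gamma_{ij}:1\le i\le m,\ j\ge1\}<1$. Let $\mathcal V$ be the (relative) interior of the set $\{(\eta_1,\dots,\eta_m)\in[0,1]^m:\eta_1+\dots+\eta_m=1\}$. For $\eta=(\eta_1,\dots,\eta_m)\in\mathcal V$ and $\omega\in A_\eta^{\mathbb N}$, let $E(\omega)\subset\mathbb R^d$ be an associated Moran fractal with contraction rates given by $\{\Psi_i\}_{1\le i\le m}$. Then the function $\Delta:\mathcal V\to\mathbb R$, $$\Delta(\eta_1,\dots,\eta_m):=\dim_{\mathrm H}(E(\omega)),$$ is real analytic on $\mathcal V$.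
   Context: Notation: $\mathbb N=\{1,2,\dots\}$; $|B|$ is the diameter of a set $B\subset\mathbb R^d$; $\dim_{\mathrm H}$ is Hausdorff dimension. Frequencies. $A=\{a_1,\dots,a_m\}$ is a finite set of $m$ positive integers. For $\omega=(s_1,s_2,\dots)\in A^{\mathbb N}$ let $\|\omega|_k\|_{a_i}=\mathrm{Card}\{1\le j\le k: s_j=a_i\}$. For a stochastic vector $\eta=(\eta_1,\dots,\eta_m)\in(0,1)^m$, $\sum_i\eta_i=1$, $A_\eta^{\mathbb N}$ is the set of $\omega\in A^{\mathbb N}$ with $\lim_{k\to\infty}\|\omega|_k\|_{a_i}/k=\eta_i$ for all $i$. Moran fractals. Given $\omega=(s_1,s_2,\dots)\in A_\eta^{\mathbb N}$, put $(c_{k1},c_{k2},\dots):=\Psi_i$ if $s_k=a_i$. Let $D_0=\{\emptyset\}$ (empty word), $D_k=\mathbb N^k$, $D=\bigcup_{k\ge0}D_k$, $D_\infty=\mathbb N^{\mathbb N}$; $\sigma|_k$ is truncation to length $k$; $\sigma*j$ is $\sigma$ followed by the letter $j$. $J\subset\mathbb R^d$ is a nonempty compact set with $J=\mathrm{cl}(\mathrm{int}\,J)$ and $|J|=1$. A collection $\{J_\sigma:\sigma\in D\}$ of nonempty subsets of $\mathbb R^d$ is admissible if: (1) $J_\emptyset=J$; (2) each $J_\sigma$ is the image of $J$ under a similarity of $\mathbb R^d$; (3) for $\sigma\in D$, the sets $J_{\sigma*1},J_{\sigma*2},\dots$ are subsets of $J_\sigma$ with pairwise disjoint interiors; (4)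 $|J_{\sigma*j}|/|J_\sigma|=c_{kj}$ for $k\ge1$, $\sigma\in D_{k-1}$, $j\ge1$. An associated Moran fractal $E(\omega)$ is any set $\bigcup_{\sigma\in D_\infty}\bigcap_{i\ge1}J_{\sigma|_i}$ obtained from an admissible collection (it is understood that such collections exist). Let $\theta_i=\inf\{t>0:\sum_j\gamma_{ij}^t<\infty\}$, $\theta=\max_i\theta_i$, and for $t>\theta$, $P(t)=P_\eta(t)=\sum_{i=1}^m\eta_i\log\sum_{j\ge1}\gamma_{ij}^t$. Standing assumptions: $\sum_j\gamma_{ij}^\theta=\infty$ for some $i$, and there is $u\in(\theta,\infty)$ with $0<P(u)<\infty$. The Hausdorff dimension of $E(\omega)$, $\omega\in A_\eta^{\mathbb N}$, is the unique zero of $P_\eta$ in $(\theta,\infty)$ (a result of the paper), so $\Delta$ is well defined: it depends only on $\eta$, not on the choice of $\omega\in A_\eta^{\mathbb N}$ or of $E(\omega)$. Real analyticity on $\mathcal V$ is understood on $\mathcal V$ as an open subset of the hyperplane $\eta_1+\dots+\eta_m=1$. *)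

theory Defs
  imports "HOL-Analysis.Analysis"
begin

section \<open>Hausdorff dimension\<close>

text \<open>
  The weight is \<open>|U|\<^sup>s\<close> with the usual conventions \<open>|{}|\<^sup>s = 0\<close> and \<open>|U|\<^sup>0 = 1\<close> for nonempty \<open>U\<close>,
  which have to be made explicit because \<open>0 powr 0 = 0\<close>. Covering sets are required to be
  bounded because \<^const>\<open>diameter\<close> is only meaningful for bounded sets.
\<close>

definition hausdorff_weight :: "real \<Rightarrow> 'a::metric_space set \<Rightarrow> ennreal" where
  "hausdorff_weight s U =
     (if U = {} then 0 else if s = 0 then 1 else ennreal (diameter U powr s))"

definition hausdorff_premeasure :: "real \<Rightarrow> real \<Rightarrow> 'a::metric_space set \<Rightarrow> ennreal" where
  "hausdorff_premeasure s \<delta> E =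
     Inf {(\<Sum>n. hausdorff_weight s (U n)) | U :: nat \<Rightarrow> 'a set.
            E \<subseteq> (\<Union>n. U n) \<and> (\<forall>n. bounded (U n) \<and> diameter (U n) \<le> \<delta>)}"

definition hausdorff_measure :: "real \<Rightarrow> 'a::metric_space set \<Rightarrow> ennreal" where
  "hausdorff_measure s E = (SUP \<delta>\<in>{0<..}. hausdorff_premeasure s \<delta> E)"

definition hausdorff_dim :: "'a::metric_space set \<Rightarrow> ennreal" where
  "hausdorff_dim E = Inf {ennreal s | s. 0 \<le> s \<and> hausdorff_measure s E = 0}"


section \<open>Sequences with prescribed frequencies and Moran fractals\<close>

text \<open>
  The alphabet is \<open>A = range a\<close> for an injective \<open>a\<close> on a finite index type with \<open>m\<close> elements.
  All sequences are indexed from \<open>0\<close>: \<open>\<omega> k\<close> is the letter \<open>s\<close> with index \<open>k + 1\<close>, and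
  \<open>\<gamma> i j\<close> is the entry number \<open>j + 1\<close> of the vector \<open>\<Psi>\<close> with index \<open>i\<close>.
\<close>

definition freq_seqs :: "('m::finite \<Rightarrow> nat) \<Rightarrow> real ^ 'm \<Rightarrow> (nat \<Rightarrow> nat) set" where
  "freq_seqs a \<eta> =
     {\<omega>. (\<forall>k. \<omega> k \<in> range a) \<and>
         (\<forall>i. (\<lambda>k. real (card {j. j < k \<and> \<omega> j = a i}) / real k) \<longlonglongrightarrow> \<eta> $ i)}"

definition similarity :: "('a::metric_space \<Rightarrow> 'a) \<Rightarrow> bool" where
  "similarity f \<longleftrightarrow> (\<exists>r>0. \<forall>x y. dist (f x) (f y) = r * dist x y)"

text \<open>
  Words are lists of natural numbers. The children of a word \<open>\<sigma>\<close> of length \<open>k - 1\<close> are scaled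
  by the \<open>k\<close>-th ratio vector, whose index is determined by the letter \<open>\<omega> (length \<sigma>)\<close>.
\<close>

definition admissible ::
  "('m \<Rightarrow> nat) \<Rightarrow> ('m \<Rightarrow> nat \<Rightarrow> real) \<Rightarrow> 'a::metric_space set \<Rightarrow> (nat \<Rightarrow> nat)
     \<Rightarrow> (nat list \<Rightarrow> 'a set) \<Rightarrow> bool" where
  "admissible a \<gamma> J \<omega> K \<longleftrightarrow>
     (\<forall>\<sigma>. K \<sigma> \<noteq> {}) \<and>
     K [] = J \<and>
     (\<forall>\<sigma>. \<exists>f. similarity f \<and> K \<sigma> = f ` J) \<and>
     (\<forall>\<sigma>. (\<forall>j. K (\<sigma> @ [j]) \<subseteq> K \<sigma>) \<and> disjoint_family (\<lambda>j. interior (K (\<sigma> @ [j])))) \<and>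
     (\<forall>\<sigma> j i. \<omega> (length \<sigma>) = a i \<longrightarrow> diameter (K (\<sigma> @ [j])) / diameter (K \<sigma>) = \<gamma> i j)"

definition moran_fractal ::
  "('m \<Rightarrow> nat) \<Rightarrow> ('m \<Rightarrow> nat \<Rightarrow> real) \<Rightarrow> 'a::metric_space set \<Rightarrow> (nat \<Rightarrow> nat)
     \<Rightarrow> 'a set \<Rightarrow> bool" where
  "moran_fractal a \<gamma> J \<omega> E \<longleftrightarrow>
     (\<exists>K. admissible a \<gamma> J \<omega> K \<and> E = (\<Union>\<sigma>. \<Inter>i\<in>{1..}. K (map \<sigma> [0..<i])))"


section \<open>The pressure function\<close>

definition theta_index :: "('m \<Rightarrow> nat \<Rightarrow> real) \<Rightarrow> 'm \<Rightarrow> real" where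
  "theta_index \<gamma> i = Inf {t. t > 0 \<and> summable (\<lambda>j. \<gamma> i j powr t)}"

definition theta :: "('m::finite \<Rightarrow> nat \<Rightarrow> real) \<Rightarrow> real" where
  "theta \<gamma> = Max (range (theta_index \<gamma>))"

text \<open>Only used for \<open>t > theta \<gamma>\<close>, where all the series converge.\<close>

definition pressure :: "('m::finite \<Rightarrow> nat \<Rightarrow> real) \<Rightarrow> real ^ 'm \<Rightarrow> real \<Rightarrow> real" where
  "pressure \<gamma> \<eta> t = (\<Sum>i\<in>UNIV. \<eta> $ i * ln (\<Sum>j. \<gamma> i j powr t))"

definition open_simplex :: "(real ^ 'm::finite) set" where
  "open_simplex =
     rel_interior {\<eta>. (\<forall>i. \<eta> $ i \<in> {0..1}) \<and> (\<Sum>i\<in>UNIV. \<eta> $ i) = 1}"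


section \<open>Real analyticity on relatively open sets\<close>

text \<open>
  \<open>f\<close> is real analytic on \<open>S\<close>, viewed as an open subset of its affine hull, if near each point
  \<open>x\<close> of \<open>S\<close> it is the sum of an (unconditionally) convergent power series in linear coordinates
  \<open>t\<close> of \<open>affine hull S\<close> centred at \<open>x\<close>. The coordinates are taken with respect to a basis \<open>B\<close> of
  the direction space; multi-indices are the extensional functions from \<open>B\<close> to \<open>nat\<close>. Linear
  changes of coordinates preserve convergent power series, so that requiring this for all
  bases or for one basis is the same. The clause \<open>x + \<dots> \<in> S\<close> expresses that \<open>S\<close> is relatively
  open.
\<close>

definition real_analytic_on_relopen :: "('a::euclidean_space \<Rightarrow> real) \<Rightarrow> 'a set \<Rightarrow> bool" where
  "real_analytic_on_relopen f S \<longleftrightarrow>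
     (\<forall>x\<in>S. \<forall>B. independent B \<and> span B = (\<lambda>y. y - x) ` (affine hull S) \<longrightarrow>
        (\<exists>c :: ('a \<Rightarrow> nat) \<Rightarrow> real. \<exists>r>0. \<forall>t :: 'a \<Rightarrow> real. (\<forall>b\<in>B. \<bar>t b\<bar> < r) \<longrightarrow>
           x + (\<Sum>b\<in>B. t b *\<^sub>R b) \<in> S \<and>
           ((\<lambda>\<alpha>. c \<alpha> * (\<Prod>b\<in>B. t b ^ \<alpha> b)) has_sum f (x + (\<Sum>b\<in>B. t b *\<^sub>R b)))
             (B \<rightarrow>\<^sub>E UNIV)))"

end

theory Submission
  imports Defs "HOL-Complex_Analysis.Cauchy_Integral_Formula"
begin

text \<open>
  The dimension of \<open>E \<eta>\<close> is the zero \<open>\<Delta> \<eta>\<close> of the pressure \<open>P\<^sub>\<eta> t = (\<Sum>i. \<eta>\<^sub>i ln (\<Sum>j. \<gamma>\<^sub>i\<^sub>j\<^sup>t))\<close>, and this zero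
  depends analytically on \<open>\<eta>\<close> because \<open>P\<^sub>\<eta>\<close> is linear in \<open>\<eta>\<close>, analytic in \<open>t\<close>, and has nonzero
  derivative in \<open>t\<close>.

  \<^bold>\<open>The dimension.\<close> The cylinders of level \<open>k\<close> have total \<open>s\<close>-weight equal to a product of \<open>k\<close> level
  sums. By the prescribed letter frequencies, \<open>1 / k\<close> times the logarithm of this product tends
  to \<open>P\<^sub>\<eta> s\<close>. For \<open>s\<close> above the zero the pressure is negative, so the weights of these covers tend
  to \<open>0\<close> (\<open>hausdorff_measure_limit_set_eq_0\<close>). For \<open>s\<close> below the zero the pressure stays positive
  when only the first \<open>N\<close> children of each cylinder are kept, for some finite \<open>N\<close>. All ratios are
  then bounded below, and a mass distribution argument shows that covers cannot have small weight
  (\<open>hausdorff_measure_limit_set_neq_0\<close>). That argument is carried out with finite sums over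
  the words of one level, so that no measure on the fractal has to be constructed.

  \<^bold>\<open>The zero.\<close> All ratios are at most some \<open>q < 1\<close>, whence \<open>P\<^sub>\<eta> (t + h) \<le> P\<^sub>\<eta> t + h ln q\<close> for \<open>h \<ge> 0\<close>
  (\<open>pressure_add_le\<close>). This one inequality yields existence and uniqueness of the zero, a nonzero
  derivative there, and a Lipschitz bound for the zero in terms of \<open>\<eta>\<close>.

  \<^bold>\<open>Analyticity.\<close> Near \<open>x\<close>, write \<open>\<eta> = x + (\<Sum>b\<in>B. t\<^sub>b b)\<close>. The zero solves an equation
  \<open>p z + (\<Sum>b\<in>B. t\<^sub>b h\<^sub>b z) = 0\<close> with \<open>p\<close> and all \<open>h\<^sub>b\<close> holomorphic near the simple zero \<open>a = \<Delta> x\<close> of \<open>p\<close>.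
  The residue theorem, integrated by parts, gives
  \<open>\<zeta> - a = - 1 / (2 \<pi> \<i>) \<integral> ln (1 + q z) dz\<close> with \<open>q = (\<Sum>b\<in>B. t\<^sub>b h\<^sub>b) / p\<close>, where the integral is over a
  small circle around \<open>a\<close>. Expanding the logarithm and the powers of \<open>q\<close> yields an absolutely
  convergent series over words in \<open>B\<close>. Grouping words by their letter counts turns it into
  the required power series (\<open>analytic_implicit_function\<close>).
\<close>

section \<open>Hausdorff measures\<close>

lemma hausdorff_weight_antimono:
  assumes "0 \<le> s" "s \<le> t" "bounded U" "diameter U \<le> 1"
  shows "hausdorff_weight t U \<le> hausdorff_weight s U"
proof -
  have d: "0 \<le> diameter U" by (rule diameter_ge_0[OF \<open>bounded U\<close>])
  show ?thesis
  proof (cases "s = 0")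
    case True
    have "diameter U powr t \<le> 1" using assms d by (intro powr_le1) auto
    then show ?thesis using True by (simp add: hausdorff_weight_def)
  next
    case False
    have "diameter U powr t \<le> diameter U powr s"
      using assms d by (cases "diameter U = 0") (auto intro: powr_mono')
    then show ?thesis using False assms by (simp add: hausdorff_weight_def ennreal_leI)
  qed
qed

lemma hausdorff_measure_eq_0_iff:
  "hausdorff_measure s E = 0 \<longleftrightarrow> (\<forall>\<delta>>0. hausdorff_premeasure s \<delta> E = 0)"
proof -
  have "hausdorff_measure s E = 0 \<longleftrightarrow> hausdorff_measure s E \<le> 0" by simp
  also have "\<dots> \<longleftrightarrow> (\<forall>\<delta>>0. hausdorff_premeasure s \<delta> E \<le> 0)"
    unfolding hausdorff_measure_def by (subst SUP_le_iff) auto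
  finally show ?thesis by simp
qed

lemma hausdorff_measure_0_mono:
  assumes "0 \<le> s" "s \<le> t" "hausdorff_measure s E = 0"
  shows "hausdorff_measure t E = 0"
  unfolding hausdorff_measure_eq_0_iff
proof (intro allI impI)
  fix \<delta> :: real assume "\<delta> > 0"
  have "hausdorff_premeasure t \<delta> E \<le> hausdorff_premeasure s (min \<delta> 1) E"
    unfolding hausdorff_premeasure_def
  proof (rule Inf_mono, safe)
    fix U :: "nat \<Rightarrow> 'a set"
    assume U: "E \<subseteq> (\<Union>n. U n)" "\<forall>n. bounded (U n) \<and> diameter (U n) \<le> min \<delta> 1"
    have "(\<Sum>n. hausdorff_weight t (U n)) \<le> (\<Sum>n. hausdorff_weight s (U n))"
      using U assms by (intro suminf_le hausdorff_weight_antimono) auto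
    with U show "\<exists>x\<in>{\<Sum>n. hausdorff_weight t (U n) |U. E \<subseteq> (\<Union>n. U n) \<and> (\<forall>n. bounded (U n) \<and> diameter (U n) \<le> \<delta>)}.
        x \<le> (\<Sum>n. hausdorff_weight s (U n))" by auto
  qed
  also have "\<dots> = 0" using assms(3) \<open>\<delta> > 0\<close> by (simp add: hausdorff_measure_eq_0_iff)
  finally show "hausdorff_premeasure t \<delta> E = 0" by simp
qed

text \<open>
  It is enough to know that the measures do not vanish for exponents just below \<open>D\<close>, since
  vanishing propagates to larger exponents. This matters because the pressure is only
  available above \<open>\<theta>\<close>.
\<close>
lemma hausdorff_dim_eqI:
  assumes "0 \<le> \<theta>" "\<theta> < D"
    and "\<And>s. D < s \<Longrightarrow> hausdorff_measure s E = 0"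
    and "\<And>s. \<theta> < s \<Longrightarrow> s < D \<Longrightarrow> hausdorff_measure s E \<noteq> 0"
  shows "hausdorff_dim E = ennreal D"
proof (rule antisym)
  show "hausdorff_dim E \<le> ennreal D"
  proof (rule ennreal_le_epsilon)
    fix e :: real assume "e > 0"
    then have "hausdorff_dim E \<le> ennreal (D + e)"
      unfolding hausdorff_dim_def using assms
      by (intro Inf_lower CollectI exI[of _ "D + e"] conjI refl) auto
    then show "hausdorff_dim E \<le> ennreal D + ennreal e"
      using assms \<open>e > 0\<close> by (simp add: ennreal_plus)
  qed
next
  show "ennreal D \<le> hausdorff_dim E"
    unfolding hausdorff_dim_def
  proof (rule Inf_greatest, safe)
    fix s assume s: "0 \<le> s" "hausdorff_measure s E = 0"
    have "D \<le> s"
    proof (rule ccontr)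
      assume "\<not> D \<le> s"
      then obtain t where t: "max s \<theta> < t" "t < D" using dense[of "max s \<theta>" D] assms(2) by auto
      then have "hausdorff_measure t E = 0" using hausdorff_measure_0_mono[of s t E] s by auto
      with assms(4)[of t] t show False by auto
    qed
    then show "ennreal D \<le> ennreal s" by (rule ennreal_leI)
  qed
qed

text \<open>
  Replacing each set of a cover by a slightly larger open ball costs an arbitrarily small amount,
  because \<open>x \<mapsto> x powr t\<close> is continuous at every \<open>x \<ge> 0\<close> when \<open>t > 0\<close>.
\<close>
lemma ball_cover_of_hausdorff_measure_0:
  fixes E :: "'a::metric_space set"
  assumes "hausdorff_measure t E = 0" "0 < t" "0 < e"
  shows "\<exists>(x :: nat \<Rightarrow> 'a) \<epsilon>. E \<subseteq> (\<Union>n. ball (x n) (\<epsilon> n)) \<and> (\<forall>n. 0 < \<epsilon> n \<and> \<epsilon> n < 1) \<and>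
    (\<forall>F. finite F \<longrightarrow> (\<Sum>n\<in>F. \<epsilon> n powr t) \<le> e)"
proof -
  have "hausdorff_premeasure t (1/2) E < ennreal (e / 2)"
    using assms by (simp add: hausdorff_measure_eq_0_iff)
  then obtain U :: "nat \<Rightarrow> 'a set" where U: "E \<subseteq> (\<Union>n. U n)"
      "\<And>n. bounded (U n)" "\<And>n. diameter (U n) \<le> 1/2"
      "(\<Sum>n. hausdorff_weight t (U n)) < ennreal (e / 2)"
    unfolding hausdorff_premeasure_def by (auto simp: Inf_less_iff)
  have "\<exists>x \<epsilon>. U n \<subseteq> ball x \<epsilon> \<and> 0 < \<epsilon> \<and> \<epsilon> < 1 \<and>
      ennreal (\<epsilon> powr t) \<le> hausdorff_weight t (U n) + ennreal (e / 2 * (1/2) ^ Suc n)" for n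
  proof -
    let ?d = "diameter (U n)" and ?e = "e / 2 * (1/2) ^ Suc n"
    have d: "0 \<le> ?d" by (rule diameter_ge_0[OF U(2)])
    have e: "?e > 0" using \<open>0 < e\<close> by simp
    have "((\<lambda>x. x powr t) \<longlongrightarrow> ?d powr t) (at_right ?d)"
      using \<open>0 < t\<close> d by (intro tendsto_powr' tendsto_ident_at tendsto_const)
        (auto simp: eventually_at_filter)
    then have "eventually (\<lambda>x. x powr t < ?d powr t + ?e) (at_right ?d)"
      using e by (intro order_tendstoD) auto
    moreover have "eventually (\<lambda>x. x < 1) (at_right ?d)"
      using U(3)[of n] by (intro order_tendstoD(2)[OF tendsto_ident_at]) simp
    moreover have "eventually (\<lambda>x. ?d < x) (at_right ?d)" by (rule eventually_at_right_less)
    ultimately have "eventually (\<lambda>x. x powr t < ?d powr t + ?e \<and> x < 1 \<and> ?d < x) (at_right ?d)"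
      by eventually_elim auto
    from eventually_happens'[OF trivial_limit_at_right_real this]
    obtain \<epsilon> where \<epsilon>: "\<epsilon> powr t < ?d powr t + ?e" "\<epsilon> < 1" "?d < \<epsilon>"
      by blast
    show ?thesis
    proof (cases "U n = {}")
      case True
      with \<epsilon> d show ?thesis by (auto simp: hausdorff_weight_def intro!: exI[of _ \<epsilon>] ennreal_leI)
    next
      case False
      then obtain x where x: "x \<in> U n" by auto
      have "U n \<subseteq> ball x \<epsilon>"
        using diameter_bounded_bound[OF U(2) x] \<epsilon> by (force simp: mem_ball)
      moreover have "ennreal (\<epsilon> powr t) \<le> hausdorff_weight t (U n) + ennreal ?e"
        using False \<epsilon> e \<open>0 < t\<close>
        by (auto simp: hausdorff_weight_def ennreal_plus[symmetric] intro!: ennreal_leI simp del: ennreal_plus)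
      moreover have "0 < \<epsilon>" using \<epsilon> d by linarith
      ultimately show ?thesis using \<epsilon>(2) by blast
    qed
  qed
  then obtain x \<epsilon> where x: "\<And>n. U n \<subseteq> ball (x n) (\<epsilon> n)" "\<And>n. 0 < \<epsilon> n" "\<And>n. \<epsilon> n < 1"
      "\<And>n. ennreal (\<epsilon> n powr t) \<le> hausdorff_weight t (U n) + ennreal (e / 2 * (1/2) ^ Suc n)"
    by metis
  have "(\<Sum>n\<in>F. \<epsilon> n powr t) \<le> e" if "finite F" for F
  proof -
    have "ennreal (\<Sum>n\<in>F. \<epsilon> n powr t) = (\<Sum>n\<in>F. ennreal (\<epsilon> n powr t))" by simp
    also have "\<dots> \<le> (\<Sum>n. ennreal (\<epsilon> n powr t))" by (rule sum_le_suminf) (auto simp: that)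
    also have "\<dots> \<le> (\<Sum>n. hausdorff_weight t (U n) + ennreal (e / 2 * (1/2) ^ Suc n))"
      by (intro suminf_le x) auto
    also have "\<dots> = (\<Sum>n. hausdorff_weight t (U n)) + (\<Sum>n. ennreal (e / 2 * (1/2) ^ Suc n))"
      by (rule suminf_add[symmetric]) auto
    also have "(\<Sum>n. ennreal (e / 2 * (1/2) ^ Suc n)) = ennreal (e / 2)"
      using sums_mult[OF power_half_series, of "e / 2"] \<open>0 < e\<close> by (intro suminf_ennreal_eq) auto
    also have "(\<Sum>n. hausdorff_weight t (U n)) + ennreal (e / 2) \<le> ennreal (e / 2) + ennreal (e / 2)"
      using U(4) by (intro add_right_mono less_imp_le)
    also have "\<dots> = ennreal e" using \<open>0 < e\<close> by (simp flip: ennreal_plus)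
    finally show ?thesis using \<open>0 < e\<close> by (simp add: ennreal_le_iff)
  qed
  moreover have "E \<subseteq> (\<Union>n. ball (x n) (\<epsilon> n))" using U(1) x(1) by blast
  ultimately show ?thesis using x(2,3) by (intro exI[of _ x] exI[of _ \<epsilon>]) blast
qed

section \<open>Moran constructions\<close>

text \<open>
  Nothing in the definition makes a similarity surjective. In finite dimension it is, because
  up to scaling and translation it is an isometry fixing the origin, hence orthogonal.
\<close>
lemma similarity_image_ball:
  fixes f :: "'a::euclidean_space \<Rightarrow> 'a"
  assumes "r > 0" "\<And>x y. dist (f x) (f y) = r * dist x y"
  shows "f ` ball x \<rho> = ball (f x) (r * \<rho>)"
proof -
  define g where "g = (\<lambda>x. (f x - f 0) /\<^sub>R r)"
  have "orthogonal_transformation g"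
    unfolding orthogonal_transformation_isometry
  proof (intro conjI allI)
    show "dist (g x) (g y) = dist x y" for x y
    proof -
      have "g x - g y = (f x - f y) /\<^sub>R r" by (simp add: g_def algebra_simps)
      then show ?thesis using assms(2)[of x y] \<open>r > 0\<close> by (simp add: dist_norm divide_simps)
    qed
  qed (simp add: g_def)
  then have "surj g" by (rule orthogonal_transformation_surj)
  have "surj f"
  proof (rule surjI)
    fix y
    have "f (inv g ((y - f 0) /\<^sub>R r)) = f 0 + r *\<^sub>R g (inv g ((y - f 0) /\<^sub>R r))"
      using \<open>r > 0\<close> by (simp add: g_def)
    then show "f (inv g ((y - f 0) /\<^sub>R r)) = y"
      using \<open>r > 0\<close> by (simp add: surj_f_inv_f[OF \<open>surj g\<close>])
  qed
  show ?thesis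
  proof (intro set_eqI iffI)
    fix y assume "y \<in> ball (f x) (r * \<rho>)"
    moreover obtain z where "y = f z" using \<open>surj f\<close> by blast
    ultimately show "y \<in> f ` ball x \<rho>" using assms by auto
  qed (use assms in auto)
qed

lemma similarity_diameter:
  assumes "r > 0" "\<And>x y. dist (f x) (f y) = r * dist x y" "bounded S"
  shows "diameter (f ` S) = r * diameter S"
proof -
  have bd: "bounded (f ` S)"
  proof -
    obtain a e where "\<forall>y\<in>S. dist a y \<le> e" using \<open>bounded S\<close> unfolding bounded_def by blast
    then have "\<forall>y\<in>f ` S. dist (f a) y \<le> r * e" using assms by auto
    then show ?thesis unfolding bounded_def by blast
  qed
  show ?thesis
  proof (cases "S = {}")
    case False
    show ?thesis
    proof (rule antisym)
      show "diameter (f ` S) \<le> r * diameter S"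
        using False diameter_bounded_bound[OF \<open>bounded S\<close>] assms(1,2)
        by (auto simp: diameter_def[of "f ` S"] intro!: cSUP_least)
      have "dist x y \<le> diameter (f ` S) / r" if "x \<in> S" "y \<in> S" for x y
        using diameter_bounded_bound[OF bd imageI[OF that(1)] imageI[OF that(2)]] assms(1,2)
        by (simp add: field_simps)
      then have "diameter S \<le> diameter (f ` S) / r"
        using False by (auto simp: diameter_def[of S] intro!: cSUP_least)
      then show "r * diameter S \<le> diameter (f ` S)" using assms(1) by (simp add: field_simps)
    qed
  qed simp
qed

text \<open>
  The geometric part of the problem only sees the ratios level by level: \<open>c n j\<close> is the ratio
  of the \<open>j\<close>-th child of any word of length \<open>n\<close>.
\<close>
locale moran_construction =
  fixes c :: "nat \<Rightarrow> nat \<Rightarrow> real" and q :: real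
    and J :: "'a::euclidean_space set" and K :: "nat list \<Rightarrow> 'a set"
  assumes c_pos: "0 < c n j" and c_le: "c n j \<le> q" and q_less_1: "q < 1"
    and compact_J: "compact J" and interior_J: "interior J \<noteq> {}" and diameter_J: "diameter J = 1"
    and K_Nil: "K [] = J"
    and K_similar: "\<exists>f. similarity f \<and> K \<sigma> = f ` J"
    and K_child_subset: "K (\<sigma> @ [j]) \<subseteq> K \<sigma>"
    and K_disjoint: "disjoint_family (\<lambda>j. interior (K (\<sigma> @ [j])))"
    and K_ratio: "diameter (K (\<sigma> @ [j])) = c (length \<sigma>) j * diameter (K \<sigma>)"
begin

definition size_of :: "nat list \<Rightarrow> real" where
  "size_of \<sigma> = (\<Prod>l<length \<sigma>. c l (\<sigma> ! l))"

definition limit_set :: "'a set" where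
  "limit_set = (\<Union>\<sigma>. \<Inter>i\<in>{1..}. K (map \<sigma> [0..<i]))"

lemma q_pos: "0 < q"
  using c_pos[of 0 0] c_le[of 0 0] by linarith

lemma size_of_Nil [simp]: "size_of [] = 1"
  by (simp add: size_of_def)

lemma size_of_snoc: "size_of (\<sigma> @ [j]) = size_of \<sigma> * c (length \<sigma>) j"
proof -
  have "(\<Prod>l<length \<sigma>. c l ((\<sigma> @ [j]) ! l)) = (\<Prod>l<length \<sigma>. c l (\<sigma> ! l))"
    by (intro prod.cong) (auto simp: nth_append)
  then show ?thesis by (simp add: size_of_def)
qed

lemma size_of_pos: "0 < size_of \<sigma>"
  unfolding size_of_def by (intro prod_pos) (simp add: c_pos)

lemma diameter_K: "diameter (K \<sigma>) = size_of \<sigma>"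
  by (induction \<sigma> rule: rev_induct) (simp_all add: K_Nil diameter_J K_ratio size_of_snoc)

lemma size_of_le: "size_of \<sigma> \<le> q ^ length \<sigma>"
  unfolding size_of_def using prod_mono[of "{..<length \<sigma>}" "\<lambda>l. c l (\<sigma> ! l)" "\<lambda>_. q"]
  by (simp add: c_le c_pos less_imp_le)

lemma compact_K: "compact (K \<sigma>)"
proof -
  obtain f where f: "similarity f" "K \<sigma> = f ` J" using K_similar by blast
  then obtain r where r: "r > 0" "\<And>x y. dist (f x) (f y) = r * dist x y" by (auto simp: similarity_def)
  have "continuous_on UNIV f"
    unfolding continuous_on_iff
  proof (intro ballI allI impI)
    fix x and e :: real assume "e > 0"
    then show "\<exists>d>0. \<forall>x'\<in>UNIV. dist x' x < d \<longrightarrow> dist (f x') (f x) < e"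
      using r by (intro exI[of _ "e / r"]) (auto simp: field_simps)
  qed
  then show ?thesis
    using compact_J f(2) by (auto intro: compact_continuous_image continuous_on_subset)
qed

lemma K_nonempty: "K \<sigma> \<noteq> {}"
  using K_similar[of \<sigma>] interior_J interior_subset[of J] by auto

lemma K_append_subset: "K (\<sigma> @ \<tau>) \<subseteq> K \<sigma>"
proof (induction \<tau> rule: rev_induct)
  case (snoc j \<tau>)
  then show ?case using K_child_subset[of "\<sigma> @ \<tau>" j] by simp
qed simp

text \<open>
  Words of which neither is a prefix of the other part at some position, and from there on their
  cylinders lie in different siblings.
\<close>
lemma K_incomparable_disjoint:
  assumes "\<And>m. take m \<sigma> \<noteq> \<sigma>'" "\<And>m. take m \<sigma>' \<noteq> \<sigma>"
  shows "interior (K \<sigma>) \<inter> interior (K \<sigma>') = {}"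
proof -
  have "\<exists>l. l < length \<sigma> \<and> l < length \<sigma>' \<and> \<sigma> ! l \<noteq> \<sigma>' ! l"
  proof (rule ccontr)
    assume neg: "\<not> ?thesis"
    show False
    proof (cases "length \<sigma> \<le> length \<sigma>'")
      case True
      then have "take (length \<sigma>) \<sigma>' = \<sigma>" using neg by (intro nth_equalityI) auto
      with assms show False by blast
    next
      case False
      then have "take (length \<sigma>') \<sigma> = \<sigma>'" using neg by (intro nth_equalityI) auto
      with assms show False by blast
    qed
  qed
  then obtain l where l: "l < length \<sigma>" "l < length \<sigma>'" "\<sigma> ! l \<noteq> \<sigma>' ! l"
    "\<And>k. k < l \<Longrightarrow> \<not> (k < length \<sigma> \<and> k < length \<sigma>' \<and> \<sigma> ! k \<noteq> \<sigma>' ! k)"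
    by (subst (asm) exists_least_iff) blast
  have eq: "take l \<sigma> = take l \<sigma>'" using l by (intro nth_equalityI) auto
  have sub: "K \<rho> \<subseteq> K (take l \<rho> @ [\<rho> ! l])" if "l < length \<rho>" for \<rho>
    using K_append_subset[of "take (Suc l) \<rho>" "drop (Suc l) \<rho>"]
    by (simp only: append_take_drop_id flip: take_Suc_conv_app_nth[OF that])
  have "interior (K (take l \<sigma> @ [\<sigma> ! l])) \<inter> interior (K (take l \<sigma> @ [\<sigma>' ! l])) = {}"
    using K_disjoint[of "take l \<sigma>"] l(3) by (auto simp: disjoint_family_on_def)
  then show ?thesis
    using interior_mono[OF sub[OF l(1)]] interior_mono[OF sub[OF l(2)]] eq by auto
qed

lemma K_contains_ball:
  obtains \<rho> where "0 < \<rho>" "\<And>\<sigma>. \<exists>y. ball y (\<rho> * size_of \<sigma>) \<subseteq> K \<sigma>"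
proof -
  obtain x \<rho> where x: "\<rho> > 0" "ball x \<rho> \<subseteq> J"
    using interior_J by (auto simp: mem_interior)
  have "\<exists>y. ball y (\<rho> * size_of \<sigma>) \<subseteq> K \<sigma>" for \<sigma>
  proof -
    obtain f where f: "similarity f" "K \<sigma> = f ` J" using K_similar by blast
    then obtain r where r: "r > 0" "\<And>x y. dist (f x) (f y) = r * dist x y" by (auto simp: similarity_def)
    have "size_of \<sigma> = r"
      using similarity_diameter[OF r compact_imp_bounded[OF compact_J]]
      by (simp add: diameter_J diameter_K flip: f(2))
    moreover have "f ` ball x \<rho> \<subseteq> f ` J" using x by blast
    ultimately show ?thesis using similarity_image_ball[OF r] f(2) by (auto simp: mult.commute)
  qed
  with x that show ?thesis by blast
qed

subsection \<open>Upper bound\<close>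

text \<open>
  Splitting off the last letter turns the sum over level \<open>k + 1\<close> into a double series whose inner
  sums all carry the same factor.
\<close>
lemma has_sum_size_of_level:
  assumes "\<And>n. summable (\<lambda>j. c n j powr s)"
  shows "((\<lambda>\<sigma>. size_of \<sigma> powr s) has_sum (\<Prod>l<k. \<Sum>j. c l j powr s)) {\<sigma>. length \<sigma> = k}"
proof (induction k)
  case 0
  have "{\<sigma> :: nat list. length \<sigma> = 0} = {[]}" by auto
  then show ?case by (auto intro!: has_sum_finiteI)
next
  case (Suc k)
  let ?f = "\<lambda>(\<sigma>, j). size_of (\<sigma> @ [j]) powr s"
  have row: "((\<lambda>j. ?f (\<sigma>, j)) has_sum size_of \<sigma> powr s * (\<Sum>j. c k j powr s)) UNIV"
    if "\<sigma> \<in> {\<sigma>. length \<sigma> = k}" for \<sigma>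
  proof -
    have "((\<lambda>j. c k j powr s) has_sum (\<Sum>j. c k j powr s)) UNIV"
      using assms[of k] by (intro norm_summable_imp_has_sum) (auto simp: summable_sums)
    from has_sum_cmult_right[OF this, of "size_of \<sigma> powr s"] show ?thesis
      using that by (simp add: size_of_snoc powr_mult size_of_pos c_pos less_imp_le)
  qed
  have col: "((\<lambda>\<sigma>. size_of \<sigma> powr s * (\<Sum>j. c k j powr s)) has_sum (\<Prod>l<Suc k. \<Sum>j. c l j powr s)) {\<sigma>. length \<sigma> = k}"
    using has_sum_cmult_left[OF Suc, of "\<Sum>j. c k j powr s"] by simp
  have "(?f has_sum (\<Prod>l<Suc k. \<Sum>j. c l j powr s)) ({\<sigma>. length \<sigma> = k} \<times> UNIV)"
    using row col has_sum_imp_summable[OF col]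
    by (intro has_sum_SigmaI[OF row col] summable_on_SigmaI[OF row]) auto
  also have "?this \<longleftrightarrow> ?case"
    by (rule has_sum_reindex_bij_witness[of _ "\<lambda>\<sigma>. (butlast \<sigma>, last \<sigma>)" "\<lambda>(\<sigma>, j). \<sigma> @ [j]"])
      (auto simp: length_Suc_conv_rev)
  finally show ?case .
qed

text \<open>The cylinders of one level are a cover, and their sizes factorise level by level.\<close>
lemma hausdorff_measure_limit_set_eq_0:
  assumes "0 < s" and summ: "\<And>n. summable (\<lambda>j. c n j powr s)"
    and lim: "(\<lambda>k. \<Prod>l<k. \<Sum>j. c l j powr s) \<longlonglongrightarrow> 0"
  shows "hausdorff_measure s limit_set = 0"
  unfolding hausdorff_measure_eq_0_iff
proof (intro allI impI)
  fix \<delta> :: real assume "\<delta> > 0"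
  have "hausdorff_premeasure s \<delta> limit_set \<le> 0"
  proof (rule ennreal_le_epsilon)
    fix e :: real assume "e > 0"
    have "(\<lambda>k. q ^ k) \<longlonglongrightarrow> 0" using q_pos q_less_1 by (intro LIMSEQ_realpow_zero) auto
    then have "eventually (\<lambda>k. q ^ k < \<delta>) sequentially" using \<open>\<delta> > 0\<close> by (rule order_tendstoD)
    moreover have "eventually (\<lambda>k. (\<Prod>l<k. \<Sum>j. c l j powr s) < e) sequentially"
      using lim \<open>e > 0\<close> by (rule order_tendstoD)
    moreover have "eventually (\<lambda>k. k \<ge> 1) sequentially" by (rule eventually_ge_at_top)
    ultimately have "eventually (\<lambda>k. q ^ k < \<delta> \<and> (\<Prod>l<k. \<Sum>j. c l j powr s) < e \<and> k \<ge> 1) sequentially"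
      by eventually_elim auto
    from eventually_happens'[OF sequentially_bot this]
    obtain k where k: "q ^ k < \<delta>" "(\<Prod>l<k. \<Sum>j. c l j powr s) < e" "k \<ge> 1"
      by blast
    define U where "U = (\<lambda>n. if length (list_decode n) = k then K (list_decode n) else {})"
    have cover: "limit_set \<subseteq> (\<Union>n. U n)"
    proof
      fix x assume "x \<in> limit_set"
      then obtain \<sigma> where "x \<in> K (map \<sigma> [0..<k])" using k(3) unfolding limit_set_def by blast
      then have "x \<in> U (list_encode (map \<sigma> [0..<k]))" by (simp add: U_def)
      then show "x \<in> (\<Union>n. U n)" by blast
    qed
    have small: "bounded (U n) \<and> diameter (U n) \<le> \<delta>" for n
      using size_of_le[of "list_decode n"] k(1) \<open>\<delta> > 0\<close> compact_imp_bounded[OF compact_K]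
      by (auto simp: U_def diameter_K)
    define g where "g = (\<lambda>\<sigma>. if length \<sigma> = k then size_of \<sigma> powr s else 0)"
    have "(g has_sum (\<Prod>l<k. \<Sum>j. c l j powr s)) UNIV"
      using has_sum_size_of_level[OF summ, of k]
      by (rule has_sum_cong_neutral[THEN iffD1, rotated -1]) (auto simp: g_def)
    then have "((\<lambda>n. g (list_decode n)) has_sum (\<Prod>l<k. \<Sum>j. c l j powr s)) UNIV"
      using has_sum_reindex_bij_betw[OF bij_list_decode, of g] by simp
    then have "(\<lambda>n. g (list_decode n)) sums (\<Prod>l<k. \<Sum>j. c l j powr s)"
      by (rule has_sum_imp_sums)
    then have "(\<Sum>n. ennreal (g (list_decode n))) = ennreal (\<Prod>l<k. \<Sum>j. c l j powr s)"
      by (intro suminf_ennreal_eq) (auto simp: g_def)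
    moreover have "hausdorff_weight s (U n) = ennreal (g (list_decode n))" for n
      using \<open>0 < s\<close> K_nonempty by (simp add: hausdorff_weight_def U_def g_def diameter_K)
    ultimately have "(\<Sum>n. hausdorff_weight s (U n)) \<le> ennreal e" using k(2) by (simp add: ennreal_leI)
    moreover have "hausdorff_premeasure s \<delta> limit_set \<le> (\<Sum>n. hausdorff_weight s (U n))"
      unfolding hausdorff_premeasure_def using cover small by (intro Inf_lower) auto
    ultimately show "hausdorff_premeasure s \<delta> limit_set \<le> 0 + ennreal e" by simp
  qed
  then show "hausdorff_premeasure s \<delta> limit_set = 0" by simp
qed

subsection \<open>Lower bound\<close>

definition words :: "nat \<Rightarrow> nat \<Rightarrow> nat list set" where
  "words N k = {\<sigma>. set \<sigma> \<subseteq> {..<N} \<and> length \<sigma> = k}"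

text \<open>
  The mass of the cylinder \<open>K \<sigma>\<close> under the natural mass distribution of exponent \<open>t\<close> on the part
  of the limit set that is coded by the first \<open>N\<close> letters.
\<close>
definition mass :: "nat \<Rightarrow> real \<Rightarrow> nat list \<Rightarrow> real" where
  "mass N t \<sigma> = (\<Prod>l<length \<sigma>. c l (\<sigma> ! l) powr t / (\<Sum>j<N. c l j powr t))"

lemma finite_words: "finite (words N k)"
  unfolding words_def by (rule finite_lists_length_eq) simp

lemma mass_nonneg: "0 \<le> mass N t \<sigma>"
  unfolding mass_def by (intro prod_nonneg) (auto intro!: divide_nonneg_nonneg sum_nonneg)

lemma mass_snoc:
  "mass N t (\<sigma> @ [j]) = mass N t \<sigma> * (c (length \<sigma>) j powr t / (\<Sum>i<N. c (length \<sigma>) i powr t))"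
proof -
  have "(\<Prod>l<length \<sigma>. c l ((\<sigma> @ [j]) ! l) powr t / (\<Sum>i<N. c l i powr t))
      = (\<Prod>l<length \<sigma>. c l (\<sigma> ! l) powr t / (\<Sum>i<N. c l i powr t))"
    by (intro prod.cong) (auto simp: nth_append)
  then show ?thesis by (simp add: mass_def)
qed

lemma mass_eq: "mass N t \<sigma> = size_of \<sigma> powr t / (\<Prod>l<length \<sigma>. \<Sum>j<N. c l j powr t)"
proof -
  have "size_of \<sigma> powr t = (\<Prod>l<length \<sigma>. c l (\<sigma> ! l) powr t)"
    unfolding size_of_def by (rule prod_powr_distrib)
  then show ?thesis by (simp add: mass_def prod_dividef)
qed

lemma mass_extensions:
  assumes "0 < N" "\<sigma> \<in> words N k"
  shows "(\<Sum>\<tau>\<in>words N m. mass N t (\<sigma> @ \<tau>)) = mass N t \<sigma>"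
proof (induction m)
  case 0
  have "words N 0 = {[]}" by (auto simp: words_def)
  then show ?case by simp
next
  case (Suc m)
  have S: "(\<Sum>j<N. c l j powr t) > 0" for l
    using \<open>0 < N\<close> less_imp_neq[OF c_pos[of l]] by (intro sum_pos) auto
  have "words N (Suc m) = (\<lambda>(\<tau>, j). \<tau> @ [j]) ` (words N m \<times> {..<N})"
    by (auto simp: words_def length_Suc_conv_rev)
  moreover have "inj_on (\<lambda>(\<tau>, j). \<tau> @ [j]) (words N m \<times> {..<N})" by (auto simp: inj_on_def)
  ultimately have "(\<Sum>\<tau>\<in>words N (Suc m). mass N t (\<sigma> @ \<tau>))
      = (\<Sum>(\<tau>, j)\<in>words N m \<times> {..<N}. mass N t ((\<sigma> @ \<tau>) @ [j]))"
    by (simp add: sum.reindex case_prod_unfold)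
  also have "\<dots> = (\<Sum>\<tau>\<in>words N m. \<Sum>j<N. mass N t ((\<sigma> @ \<tau>) @ [j]))"
    by (rule sum.cartesian_product[symmetric])
  also have "\<dots> = (\<Sum>\<tau>\<in>words N m. mass N t (\<sigma> @ \<tau>))"
  proof (rule sum.cong[OF refl])
    fix \<tau>
    show "(\<Sum>j<N. mass N t ((\<sigma> @ \<tau>) @ [j])) = mass N t (\<sigma> @ \<tau>)"
      unfolding mass_snoc sum_distrib_left[symmetric] sum_divide_distrib[symmetric]
      using S[of "length (\<sigma> @ \<tau>)"] by simp
  qed
  finally show ?case using Suc by simp
qed

text \<open>
  Stop every word the first time its cylinder has size at most \<open>\<epsilon>\<close>. The stopped cylinders have
  size between \<open>\<kappa> \<epsilon>\<close> and \<open>\<epsilon>\<close> and disjoint interiors, so they contain disjoint balls of radius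
  comparable to \<open>\<epsilon>\<close>. Comparing volumes, boundedly many of them meet a given ball of radius \<open>\<epsilon>\<close>.
\<close>
lemma card_antichain_near_ball_le:
  assumes "0 < \<kappa>"
  shows "\<exists>M>0. \<forall>C u \<epsilon>. finite C \<longrightarrow> 0 < \<epsilon> \<longrightarrow>
      (\<forall>\<sigma>\<in>C. \<kappa> * \<epsilon> \<le> size_of \<sigma> \<and> size_of \<sigma> \<le> \<epsilon> \<and> K \<sigma> \<inter> ball u \<epsilon> \<noteq> {}) \<longrightarrow>
      pairwise (\<lambda>\<sigma> \<sigma>'. interior (K \<sigma>) \<inter> interior (K \<sigma>') = {}) C \<longrightarrow> real (card C) \<le> M"
proof -
  obtain \<rho> where \<rho>: "0 < \<rho>" "\<And>\<sigma>. \<exists>y. ball y (\<rho> * size_of \<sigma>) \<subseteq> K \<sigma>" using K_contains_ball by blast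
  let ?d = "DIM('a)"
  show ?thesis
  proof (intro exI[of _ "(2 / (\<rho> * \<kappa>)) ^ ?d"] conjI allI impI)
    show "0 < (2 / (\<rho> * \<kappa>)) ^ ?d" using \<rho> \<open>0 < \<kappa>\<close> by simp
    fix C u and \<epsilon> :: real
    assume fin: "finite C" and eps: "0 < \<epsilon>"
      and C': "\<forall>\<sigma>\<in>C. \<kappa> * \<epsilon> \<le> size_of \<sigma> \<and> size_of \<sigma> \<le> \<epsilon> \<and> K \<sigma> \<inter> ball u \<epsilon> \<noteq> {}"
      and disj: "pairwise (\<lambda>\<sigma> \<sigma>'. interior (K \<sigma>) \<inter> interior (K \<sigma>') = {}) C"
    note C = bspec[OF C']
    from \<rho>(2) obtain y where y: "\<And>\<sigma>. ball (y \<sigma>) (\<rho> * size_of \<sigma>) \<subseteq> K \<sigma>" by metis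
    let ?r = "\<rho> * (\<kappa> * \<epsilon>)"
    let ?B = "\<lambda>\<sigma>. ball (y \<sigma>) ?r"
    have r: "?r > 0" using \<rho> \<open>0 < \<kappa>\<close> eps by simp
    have BK: "?B \<sigma> \<subseteq> K \<sigma>" if "\<sigma> \<in> C" for \<sigma>
      using C[OF that] \<rho>(1) by (intro order_trans[OF subset_ball y]) auto
    then have Bint: "?B \<sigma> \<subseteq> interior (K \<sigma>)" if "\<sigma> \<in> C" for \<sigma>
      using that by (intro interior_maximal) auto
    have Bu: "?B \<sigma> \<subseteq> cball u (2 * \<epsilon>)" if \<sigma>: "\<sigma> \<in> C" for \<sigma>
    proof
      fix x assume "x \<in> ?B \<sigma>"
      then have x: "x \<in> K \<sigma>" using BK[OF \<sigma>] by auto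
      obtain z where z: "z \<in> K \<sigma>" "dist u z < \<epsilon>" using C[OF \<sigma>] by auto
      have "dist z x \<le> \<epsilon>"
        using diameter_bounded_bound[OF compact_imp_bounded[OF compact_K] z(1) x] C[OF \<sigma>]
        by (simp add: diameter_K)
      then show "x \<in> cball u (2 * \<epsilon>)" using z(2) dist_triangle[of u x z] by simp
    qed
    let ?v = "unit_ball_vol (real ?d)"
    have v: "?v > 0" by simp
    have "real (card C) * (?v * ?r ^ ?d) = (\<Sum>\<sigma>\<in>C. measure lborel (?B \<sigma>))"
      using r by (simp add: content_ball)
    also have "\<dots> = measure lborel (\<Union>\<sigma>\<in>C. ?B \<sigma>)"
    proof (rule measure_finite_Union[symmetric])
      show "disjoint_family_on ?B C"
        unfolding disjoint_family_on_def using Bint disj unfolding pairwise_def by fast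
      show "emeasure lborel (?B \<sigma>) \<noteq> \<infinity>" if "\<sigma> \<in> C" for \<sigma>
        using emeasure_bounded_finite[of "?B \<sigma>"] by auto
    qed (use fin in auto)
    also have "\<dots> \<le> measure lborel (cball u (2 * \<epsilon>))"
      using Bu emeasure_bounded_finite[of "cball u (2 * \<epsilon>)"]
      by (intro measure_mono_fmeasurable) (auto simp: fmeasurable_def fin)
    also have "\<dots> = ?v * (2 * \<epsilon>) ^ ?d" using eps by (simp add: content_cball)
    finally have "real (card C) * ?r ^ ?d \<le> (2 * \<epsilon>) ^ ?d"
      using v by (simp add: mult.left_commute[of _ ?v])
    then have "real (card C) \<le> (2 * \<epsilon>) ^ ?d / ?r ^ ?d"
      using r by (simp add: pos_le_divide_eq)
    also have "\<dots> = (2 / (\<rho> * \<kappa>)) ^ ?d"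
    proof -
      have "2 * \<epsilon> / ?r = 2 / (\<rho> * \<kappa>)" using eps \<rho> \<open>0 < \<kappa>\<close> by (simp add: field_simps)
      then show ?thesis by (simp only: flip: power_divide)
    qed
    finally show "real (card C) \<le> (2 / (\<rho> * \<kappa>)) ^ ?d" .
  qed
qed

text \<open>
  The words of level \<open>L\<close> whose cylinder meets the ball are grouped by the prefix at which they are
  stopped. Each group has at most the mass of its prefix, which is of order \<open>\<epsilon> powr t\<close> because
  the level sums have products bounded below, and there are boundedly many groups.
\<close>
lemma mass_near_ball_le:
  assumes "0 < t" "0 < N" and \<kappa>: "0 < \<kappa>" "\<And>n j. j < N \<Longrightarrow> \<kappa> \<le> c n j"
    and m: "0 < m" "\<And>k. m \<le> (\<Prod>l<k. \<Sum>j<N. c l j powr t)"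
  shows "\<exists>M>0. \<forall>u \<epsilon> L. 0 < \<epsilon> \<longrightarrow> \<epsilon> < 1 \<longrightarrow> q ^ L \<le> \<epsilon> \<longrightarrow>
      (\<Sum>\<tau>\<in>{\<tau>\<in>words N L. K \<tau> \<inter> ball u \<epsilon> \<noteq> {}}. mass N t \<tau>) \<le> M * \<epsilon> powr t"
proof -
  from card_antichain_near_ball_le[OF \<kappa>(1)]
  obtain M where M: "0 < M" "\<And>C u \<epsilon>. finite C \<Longrightarrow> 0 < \<epsilon> \<Longrightarrow>
      (\<forall>\<sigma>\<in>C. \<kappa> * \<epsilon> \<le> size_of \<sigma> \<and> size_of \<sigma> \<le> \<epsilon> \<and> K \<sigma> \<inter> ball u \<epsilon> \<noteq> {}) \<Longrightarrow>
      pairwise (\<lambda>\<sigma> \<sigma>'. interior (K \<sigma>) \<inter> interior (K \<sigma>') = {}) C \<Longrightarrow> real (card C) \<le> M"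
    by (elim exE conjE) blast
  show ?thesis
  proof (intro exI[of _ "M / m"] conjI allI impI)
    show "0 < M / m" using M m by simp
    fix u and \<epsilon> :: real and L
    assume eps: "0 < \<epsilon>" "\<epsilon> < 1" "q ^ L \<le> \<epsilon>"
    define Q where "Q = {\<tau>\<in>words N L. K \<tau> \<inter> ball u \<epsilon> \<noteq> {}}"
    define stop where "stop = (\<lambda>\<tau>. LEAST n. size_of (take n \<tau>) \<le> \<epsilon>)"
    define cut where "cut = (\<lambda>\<tau>. take (stop \<tau>) \<tau>)"
    have finQ: "finite Q" using finite_words by (simp add: Q_def)
    have stop_le: "stop \<tau> \<le> L" and cut_le: "size_of (cut \<tau>) \<le> \<epsilon>" if "\<tau> \<in> words N L" for \<tau>
    proof -
      have *: "size_of (take L \<tau>) \<le> \<epsilon>"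
        using size_of_le[of \<tau>] that eps(3) by (simp add: words_def)
      show "stop \<tau> \<le> L" unfolding stop_def by (rule Least_le) (rule *)
      show "size_of (cut \<tau>) \<le> \<epsilon>" unfolding stop_def cut_def by (rule LeastI) (rule *)
    qed
    have before: "\<epsilon> < size_of (take n \<tau>)" if "n < stop \<tau>" for n \<tau>
      using not_less_Least[of n "\<lambda>n. size_of (take n \<tau>) \<le> \<epsilon>"] that by (simp add: stop_def)
    have cut_ge: "\<kappa> * \<epsilon> \<le> size_of (cut \<tau>)" if \<tau>: "\<tau> \<in> words N L" for \<tau>
    proof -
      \<comment> \<open>The empty word has size \<open>1 > \<epsilon>\<close>, so the stopped prefix has a last letter, and without this
        letter its size still exceeds \<open>\<epsilon>\<close>.\<close>
      have "stop \<tau> \<noteq> 0" using cut_le[OF \<tau>] eps(2) by (intro notI) (simp add: cut_def)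
      then obtain n where n: "stop \<tau> = Suc n" using not0_implies_Suc by blast
      then have "n < length \<tau>" using stop_le[OF \<tau>] \<tau> by (simp add: words_def)
      moreover from this have "\<tau> ! n < N" using \<tau> nth_mem by (fastforce simp: words_def)
      ultimately have "size_of (cut \<tau>) = size_of (take n \<tau>) * c n (\<tau> ! n)"
        by (simp add: cut_def n take_Suc_conv_app_nth size_of_snoc)
      moreover have "\<epsilon> * \<kappa> \<le> size_of (take n \<tau>) * c n (\<tau> ! n)"
        using before[of n \<tau>] n \<kappa>(1) \<kappa>(2)[OF \<open>\<tau> ! n < N\<close>] size_of_pos[of "take n \<tau>"] by (intro mult_mono) auto
      ultimately show ?thesis by (simp add: mult.commute)
    qed
    have cut_words: "cut \<tau> \<in> words N (length (cut \<tau>))" if "\<tau> \<in> words N L" for \<tau>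
      using that set_take_subset[of "stop \<tau>" \<tau>] by (auto simp: words_def cut_def)
    \<comment> \<open>A proper prefix of a stopped word is still larger than \<open>\<epsilon>\<close>, so it is not itself stopped.\<close>
    have no_prefix: "take n (cut \<tau>) \<noteq> cut \<tau>'" if "\<tau> \<in> words N L" "\<tau>' \<in> words N L" "cut \<tau> \<noteq> cut \<tau>'" for n \<tau> \<tau>'
    proof
      assume eq: "take n (cut \<tau>) = cut \<tau>'"
      have "n < length (cut \<tau>)" using eq that(3) by (metis not_le take_all)
      then have "\<epsilon> < size_of (take n \<tau>)" by (intro before) (simp add: cut_def)
      moreover have "take n (cut \<tau>) = take n \<tau>"
        using \<open>n < length (cut \<tau>)\<close> by (simp add: cut_def min_absorb1)
      ultimately show False using cut_le[OF that(2)] eq by simp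
    qed
    have card: "real (card (cut ` Q)) \<le> M"
    proof (rule M(2)[OF _ eps(1)])
      show "\<forall>\<sigma>\<in>cut ` Q. \<kappa> * \<epsilon> \<le> size_of \<sigma> \<and> size_of \<sigma> \<le> \<epsilon> \<and> K \<sigma> \<inter> ball u \<epsilon> \<noteq> {}"
      proof
        fix \<sigma> assume "\<sigma> \<in> cut ` Q"
        then obtain \<tau> where \<tau>: "\<tau> \<in> Q" "\<sigma> = cut \<tau>" by blast
        have "K \<tau> \<subseteq> K \<sigma>"
          using K_append_subset[of "cut \<tau>" "drop (stop \<tau>) \<tau>"] \<tau>(2) by (simp add: cut_def)
        then show "\<kappa> * \<epsilon> \<le> size_of \<sigma> \<and> size_of \<sigma> \<le> \<epsilon> \<and> K \<sigma> \<inter> ball u \<epsilon> \<noteq> {}"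
          using \<tau> cut_ge[of \<tau>] cut_le[of \<tau>] by (auto simp: Q_def)
      qed
      show "pairwise (\<lambda>\<sigma> \<sigma>'. interior (K \<sigma>) \<inter> interior (K \<sigma>') = {}) (cut ` Q)"
      proof (rule pairwiseI)
        fix \<sigma> \<sigma>' assume "\<sigma> \<in> cut ` Q" "\<sigma>' \<in> cut ` Q" "\<sigma> \<noteq> \<sigma>'"
        then obtain \<tau> \<tau>' where "\<tau> \<in> words N L" "\<tau>' \<in> words N L" "cut \<tau> \<noteq> cut \<tau>'" "\<sigma> = cut \<tau>" "\<sigma>' = cut \<tau>'"
          by (auto simp: Q_def)
        then show "interior (K \<sigma>) \<inter> interior (K \<sigma>') = {}"
          using no_prefix[of \<tau> \<tau>'] no_prefix[of \<tau>' \<tau>] by (intro K_incomparable_disjoint) auto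
      qed
    qed (use finQ in auto)
    have fibre: "(\<Sum>\<tau>\<in>{\<tau>\<in>Q. cut \<tau> = \<sigma>}. mass N t \<tau>) \<le> \<epsilon> powr t / m" if "\<sigma> \<in> cut ` Q" for \<sigma>
    proof -
      obtain \<tau>0 where \<tau>0: "\<tau>0 \<in> words N L" "\<sigma> = cut \<tau>0" using \<open>\<sigma> \<in> cut ` Q\<close> by (auto simp: Q_def)
      have sub: "{\<tau>\<in>Q. cut \<tau> = \<sigma>} \<subseteq> (@) \<sigma> ` words N (L - length \<sigma>)"
      proof
        fix \<tau> assume "\<tau> \<in> {\<tau>\<in>Q. cut \<tau> = \<sigma>}"
        then have \<tau>: "\<tau> \<in> words N L" "cut \<tau> = \<sigma>" by (auto simp: Q_def)
        have "\<tau> = \<sigma> @ drop (stop \<tau>) \<tau>" using \<tau>(2) by (simp add: cut_def flip: \<tau>(2))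
        moreover have "drop (stop \<tau>) \<tau> \<in> words N (L - length \<sigma>)"
          using \<tau> set_drop_subset[of "stop \<tau>" \<tau>] stop_le[OF \<tau>(1)]
          by (auto simp: words_def cut_def)
        ultimately show "\<tau> \<in> (@) \<sigma> ` words N (L - length \<sigma>)" by blast
      qed
      have "(\<Sum>\<tau>\<in>{\<tau>\<in>Q. cut \<tau> = \<sigma>}. mass N t \<tau>) \<le> (\<Sum>\<tau>\<in>(@) \<sigma> ` words N (L - length \<sigma>). mass N t \<tau>)"
        by (rule sum_mono2[OF _ sub]) (auto simp: finite_words mass_nonneg)
      also have "\<dots> = (\<Sum>\<tau>\<in>words N (L - length \<sigma>). mass N t (\<sigma> @ \<tau>))"
        by (subst sum.reindex) (auto simp: inj_on_def)
      also have "\<dots> = mass N t \<sigma>"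
        using mass_extensions[OF \<open>0 < N\<close> cut_words[OF \<tau>0(1)]] \<tau>0(2) by simp
      also have "\<dots> \<le> \<epsilon> powr t / m"
        unfolding mass_eq using cut_le[OF \<tau>0(1)] \<tau>0(2) size_of_pos[of \<sigma>] m \<open>0 < t\<close>
        by (intro frac_le powr_mono2) auto
      finally show ?thesis .
    qed
    have "(\<Sum>\<tau>\<in>Q. mass N t \<tau>) = (\<Sum>\<sigma>\<in>cut ` Q. \<Sum>\<tau>\<in>{\<tau>\<in>Q. cut \<tau> = \<sigma>}. mass N t \<tau>)"
      by (rule sum.image_gen[OF finQ])
    also have "\<dots> \<le> (\<Sum>\<sigma>\<in>cut ` Q. \<epsilon> powr t / m)" by (rule sum_mono[OF fibre])
    also have "\<dots> = real (card (cut ` Q)) * (\<epsilon> powr t / m)" by simp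
    also have "\<dots> \<le> M * (\<epsilon> powr t / m)" using card m by (intro mult_right_mono) auto
    finally show "(\<Sum>\<tau>\<in>{\<tau>\<in>words N L. K \<tau> \<inter> ball u \<epsilon> \<noteq> {}}. mass N t \<tau>) \<le> M / m * \<epsilon> powr t"
      by (simp add: Q_def)
  qed
qed

text \<open>
  Compactness in the form of Koenig's lemma: a word all of whose long extensions fail to be covered
  finitely has a child with the same property, and following such children leads to a point of
  the limit set. The open set that covers this point swallows a whole cylinder around it.
\<close>
lemma finite_subcover_of_words:
  fixes G :: "nat \<Rightarrow> 'a set"
  assumes "limit_set \<subseteq> (\<Union>n. G n)" "\<And>n. open (G n)"
  shows "\<exists>F L. finite F \<and> (\<forall>k\<ge>L. \<forall>\<tau>\<in>words N k. \<exists>n\<in>F. K \<tau> \<subseteq> G n)"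
proof (rule ccontr)
  define good where "good = (\<lambda>\<sigma>. \<exists>F L. finite F \<and> (\<forall>k\<ge>L. \<forall>\<tau>\<in>words N k. \<exists>n\<in>F. K (\<sigma> @ \<tau>) \<subseteq> G n))"
  assume "\<not> ?thesis"
  then have bad: "\<not> good []" by (simp add: good_def)
  have step: "\<exists>j. \<not> good (\<sigma> @ [j])" if "\<not> good \<sigma>" for \<sigma>
  proof (rule ccontr)
    assume "\<nexists>j. \<not> good (\<sigma> @ [j])"
    then have "\<forall>j. \<exists>F L. finite F \<and> (\<forall>k\<ge>L. \<forall>\<tau>\<in>words N k. \<exists>n\<in>F. K ((\<sigma> @ [j]) @ \<tau>) \<subseteq> G n)"
      by (simp add: good_def)
    then obtain F L where FL: "\<And>j. finite (F j)"
        "\<And>j k \<tau>. k \<ge> L j \<Longrightarrow> \<tau> \<in> words N k \<Longrightarrow> \<exists>n\<in>F j. K ((\<sigma> @ [j]) @ \<tau>) \<subseteq> G n"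
      by metis
    have "\<exists>n\<in>(\<Union>j<N. F j). K (\<sigma> @ \<tau>) \<subseteq> G n" if "k \<ge> Suc (\<Sum>j<N. L j)" "\<tau> \<in> words N k" for k \<tau>
    proof -
      have "length \<tau> = k" using that(2) by (simp add: words_def)
      with that(1) obtain j \<tau>' where \<tau>: "\<tau> = j # \<tau>'" by (cases \<tau>) auto
      then have j: "j < N" "\<tau>' \<in> words N (k - 1)" using that(2) by (auto simp: words_def)
      have "L j \<le> (\<Sum>j<N. L j)" using j(1) by (intro member_le_sum) auto
      then have "L j \<le> k - 1" using that(1) by linarith
      from FL(2)[OF this j(2)] show ?thesis using j(1) \<tau> by auto
    qed
    then have "good \<sigma>" unfolding good_def
      using FL(1) by (intro exI[of _ "\<Union>j<N. F j"] exI[of _ "Suc (\<Sum>j<N. L j)"]) auto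
    with that show False by contradiction
  qed
  have "\<exists>f. \<forall>n. (\<not> good (f n) \<and> length (f n) = n) \<and> (\<exists>j. f (Suc n) = f n @ [j])"
  proof (rule dependent_nat_choice)
    show "\<exists>\<sigma>. \<not> good \<sigma> \<and> length \<sigma> = 0" using bad by auto
    show "\<exists>\<sigma>'. (\<not> good \<sigma>' \<and> length \<sigma>' = Suc n) \<and> (\<exists>j. \<sigma>' = \<sigma> @ [j])"
      if \<sigma>: "\<not> good \<sigma> \<and> length \<sigma> = n" for \<sigma> n
    proof -
      obtain j where "\<not> good (\<sigma> @ [j])" using step \<sigma> by blast
      then show ?thesis using \<sigma> by (intro exI[of _ "\<sigma> @ [j]"]) auto
    qed
  qed
  then obtain f where f: "\<And>n. \<not> good (f n)" "\<And>n. length (f n) = n" "\<And>n. \<exists>j. f (Suc n) = f n @ [j]"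
    by blast
  define \<sigma> where "\<sigma> = (\<lambda>n. last (f (Suc n)))"
  have f_eq: "f n = map \<sigma> [0..<n]" for n
  proof (induction n)
    case (Suc n)
    then show ?case using f(3)[of n] by (auto simp: \<sigma>_def)
  qed (use f(2)[of 0] in auto)
  have decr: "K (f n) \<subseteq> K (f m)" if "m \<le> n" for m n
    using that
  proof (induction rule: dec_induct)
    case (step n)
    then show ?case using f(3)[of n] K_child_subset[of "f n"] by fastforce
  qed simp
  have "\<Inter>(range (\<lambda>n. K (f n))) \<noteq> {}"
    by (rule compact_nest) (auto simp: compact_K K_nonempty dest: decr)
  then obtain x where x: "\<And>n. x \<in> K (f n)" by auto
  then have "x \<in> limit_set" unfolding limit_set_def f_eq by blast
  then obtain n where "x \<in> G n" using assms(1) by blast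
  then obtain \<delta> where \<delta>: "\<delta> > 0" "ball x \<delta> \<subseteq> G n" using assms(2) open_contains_ball by blast
  obtain k where k: "q ^ k < \<delta>" using real_arch_pow_inv[OF \<delta>(1) q_less_1] by blast
  have "K (f k) \<subseteq> ball x \<delta>"
  proof
    fix y assume "y \<in> K (f k)"
    then have "dist x y \<le> size_of (f k)"
      using diameter_bounded_bound[OF compact_imp_bounded[OF compact_K] x] by (simp add: diameter_K)
    also have "\<dots> < \<delta>" using size_of_le[of "f k"] k f(2) by simp
    finally show "y \<in> ball x \<delta>" by simp
  qed
  then have "K (f k @ \<tau>) \<subseteq> G n" for \<tau> using K_append_subset[of "f k" \<tau>] \<delta>(2) by blast
  then have "good (f k)" unfolding good_def by (intro exI[of _ "{n}"] exI[of _ 0]) auto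
  with f(1) show False by blast
qed

text \<open>
  The mass distribution principle, carried out on words of one large level: the total mass is
  \<open>1\<close>, a ball of radius \<open>\<epsilon>\<close> catches at most \<open>M \<epsilon>\<^sup>t\<close> of it, so no cover by balls can
  make the sum of the \<open>\<epsilon>\<^sup>t\<close> small.
\<close>
lemma hausdorff_measure_limit_set_neq_0:
  assumes "0 < t" and \<kappa>: "0 < \<kappa>" "\<And>n j. j < N \<Longrightarrow> \<kappa> \<le> c n j"
    and m: "0 < m" "\<And>k. m \<le> (\<Prod>l<k. \<Sum>j<N. c l j powr t)"
  shows "hausdorff_measure t limit_set \<noteq> 0"
proof
  assume H: "hausdorff_measure t limit_set = 0"
  have "0 < N" using m(1) m(2)[of 1] by (cases N) auto
  have "\<exists>M>0. \<forall>u \<epsilon> L. 0 < \<epsilon> \<longrightarrow> \<epsilon> < 1 \<longrightarrow> q ^ L \<le> \<epsilon> \<longrightarrow>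
      (\<Sum>\<tau>\<in>{\<tau>\<in>words N L. K \<tau> \<inter> ball u \<epsilon> \<noteq> {}}. mass N t \<tau>) \<le> M * \<epsilon> powr t"
    by (rule mass_near_ball_le[OF \<open>0 < t\<close> \<open>0 < N\<close> \<kappa>(1) _ m]) (rule \<kappa>(2))
  then obtain M where M: "0 < M" "\<And>u \<epsilon> L. 0 < \<epsilon> \<Longrightarrow> \<epsilon> < 1 \<Longrightarrow> q ^ L \<le> \<epsilon> \<Longrightarrow>
      (\<Sum>\<tau>\<in>{\<tau>\<in>words N L. K \<tau> \<inter> ball u \<epsilon> \<noteq> {}}. mass N t \<tau>) \<le> M * \<epsilon> powr t"
    by (elim exE conjE) blast
  have "0 < 1 / (2 * M)" using M by simp
  from ball_cover_of_hausdorff_measure_0[OF H \<open>0 < t\<close> \<open>0 < 1 / (2 * M)\<close>]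
  obtain x :: "nat \<Rightarrow> 'a" and \<epsilon> :: "nat \<Rightarrow> real"
    where x: "limit_set \<subseteq> (\<Union>n. ball (x n) (\<epsilon> n))" "\<And>n. 0 < \<epsilon> n" "\<And>n. \<epsilon> n < 1"
      "\<And>F. finite F \<Longrightarrow> (\<Sum>n\<in>F. \<epsilon> n powr t) \<le> 1 / (2 * M)"
    by metis
  from finite_subcover_of_words[OF x(1) open_ball, of N]
  obtain F L where FL: "finite F" "\<And>k \<tau>. k \<ge> L \<Longrightarrow> \<tau> \<in> words N k \<Longrightarrow> \<exists>n\<in>F. K \<tau> \<subseteq> ball (x n) (\<epsilon> n)"
    by metis
  have "(\<lambda>k. q ^ k) \<longlonglongrightarrow> 0" using q_pos q_less_1 by (intro LIMSEQ_realpow_zero) auto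
  then have "eventually (\<lambda>k. q ^ k < \<epsilon> n) sequentially" for n using x(2)[of n] by (rule order_tendstoD)
  then have "eventually (\<lambda>k. \<forall>n\<in>F. q ^ k < \<epsilon> n) sequentially"
    using FL(1) by (simp add: eventually_ball_finite)
  then have "eventually (\<lambda>k. (\<forall>n\<in>F. q ^ k < \<epsilon> n) \<and> L \<le> k) sequentially"
    using eventually_ge_at_top by (rule eventually_conj)
  from eventually_happens'[OF sequentially_bot this]
  obtain k where k: "\<And>n. n \<in> F \<Longrightarrow> q ^ k < \<epsilon> n" "L \<le> k" by blast
  let ?Q = "\<lambda>n. {\<tau>\<in>words N k. K \<tau> \<inter> ball (x n) (\<epsilon> n) \<noteq> {}}"
  have "[] \<in> words N 0" by (simp add: words_def)
  from mass_extensions[OF \<open>0 < N\<close> this, of t k]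
  have "1 = (\<Sum>\<tau>\<in>words N k. mass N t \<tau>)" by (simp add: mass_def)
  also have "\<dots> \<le> (\<Sum>\<tau>\<in>words N k. \<Sum>n\<in>F. if K \<tau> \<inter> ball (x n) (\<epsilon> n) \<noteq> {} then mass N t \<tau> else 0)"
  proof (rule sum_mono)
    fix \<tau> assume "\<tau> \<in> words N k"
    then obtain n where n: "n \<in> F" "K \<tau> \<subseteq> ball (x n) (\<epsilon> n)" using FL(2)[OF k(2)] by blast
    then have "mass N t \<tau> = (if K \<tau> \<inter> ball (x n) (\<epsilon> n) \<noteq> {} then mass N t \<tau> else 0)"
      using K_nonempty[of \<tau>] by auto
    also have "\<dots> \<le> (\<Sum>n\<in>F. if K \<tau> \<inter> ball (x n) (\<epsilon> n) \<noteq> {} then mass N t \<tau> else 0)"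
      by (rule member_le_sum[OF n(1)]) (auto simp: mass_nonneg FL(1))
    finally show "mass N t \<tau> \<le> (\<Sum>n\<in>F. if K \<tau> \<inter> ball (x n) (\<epsilon> n) \<noteq> {} then mass N t \<tau> else 0)" .
  qed
  also have "\<dots> = (\<Sum>n\<in>F. \<Sum>\<tau>\<in>?Q n. mass N t \<tau>)"
    by (subst sum.swap) (simp add: sum.inter_filter finite_words)
  also have "\<dots> \<le> (\<Sum>n\<in>F. M * \<epsilon> n powr t)"
    using k(1) x(2,3) by (intro sum_mono M(2)) (auto intro: less_imp_le)
  also have "\<dots> = M * (\<Sum>n\<in>F. \<epsilon> n powr t)" by (simp add: sum_distrib_left)
  also have "\<dots> \<le> M * (1 / (2 * M))" using x(4)[OF FL(1)] M(1) by (intro mult_left_mono) auto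
  finally show False using M(1) by simp
qed

end

section \<open>Letter frequencies\<close>

text \<open>
  An average along the sequence only depends on how often each letter has occurred, because the
  alphabet is finite.
\<close>
lemma freq_seqs_average:
  fixes v :: "'m::finite \<Rightarrow> real"
  assumes "inj a" "\<omega> \<in> freq_seqs a \<eta>"
  shows "(\<lambda>k. (\<Sum>l<k. v (inv a (\<omega> l))) / real k) \<longlonglongrightarrow> (\<Sum>i\<in>UNIV. \<eta> $ i * v i)"
proof -
  have "(\<lambda>k. \<Sum>i\<in>UNIV. real (card {j. j < k \<and> \<omega> j = a i}) / real k * v i) \<longlonglongrightarrow> (\<Sum>i\<in>UNIV. \<eta> $ i * v i)"
    using assms(2) by (intro tendsto_intros) (auto simp: freq_seqs_def)
  moreover have "(\<Sum>i\<in>UNIV. real (card {j. j < k \<and> \<omega> j = a i}) / real k * v i)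
      = (\<Sum>l<k. v (inv a (\<omega> l))) / real k" for k
  proof -
    have inv: "a (inv a (\<omega> l)) = \<omega> l" for l
      using assms(2) by (intro f_inv_into_f) (auto simp: freq_seqs_def)
    have "(\<Sum>l<k. v (inv a (\<omega> l))) = (\<Sum>i\<in>UNIV. \<Sum>l\<in>{l\<in>{..<k}. inv a (\<omega> l) = i}. v (inv a (\<omega> l)))"
      by (rule sum.group[symmetric]) auto
    also have "\<dots> = (\<Sum>i\<in>UNIV. real (card {j. j < k \<and> \<omega> j = a i}) * v i)"
    proof (rule sum.cong[OF refl])
      fix i
      have "{l\<in>{..<k}. inv a (\<omega> l) = i} = {j. j < k \<and> \<omega> j = a i}"
        using inv inv_f_f[OF assms(1), of i] by auto
      moreover have "(\<Sum>l\<in>{l\<in>{..<k}. inv a (\<omega> l) = i}. v (inv a (\<omega> l))) = (\<Sum>l\<in>{l\<in>{..<k}. inv a (\<omega> l) = i}. v i)"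
        by (rule sum.cong) auto
      ultimately show "(\<Sum>l\<in>{l\<in>{..<k}. inv a (\<omega> l) = i}. v (inv a (\<omega> l))) = real (card {j. j < k \<and> \<omega> j = a i}) * v i"
        by simp
    qed
    finally show ?thesis by (simp add: sum_divide_distrib)
  qed
  ultimately show ?thesis by simp
qed

lemma prod_tendsto_0_of_average_ln_neg:
  fixes f :: "nat \<Rightarrow> real"
  assumes "\<And>l. 0 < f l" "(\<lambda>k. (\<Sum>l<k. ln (f l)) / real k) \<longlonglongrightarrow> L" "L < 0"
  shows "(\<lambda>k. \<Prod>l<k. f l) \<longlonglongrightarrow> 0"
proof (rule tendsto_sandwich[of "\<lambda>_. 0" _ _ "\<lambda>k. exp (L / 2) ^ k"])
  have "eventually (\<lambda>k. (\<Sum>l<k. ln (f l)) / real k < L / 2) sequentially"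
    using assms(2,3) by (intro order_tendstoD) auto
  then show "eventually (\<lambda>k. (\<Prod>l<k. f l) \<le> exp (L / 2) ^ k) sequentially"
    using eventually_gt_at_top[of 0]
  proof eventually_elim
    case (elim k)
    have "(\<Prod>l<k. f l) = exp (\<Sum>l<k. ln (f l))" by (simp add: exp_sum assms(1))
    also have "\<dots> \<le> exp (real k * (L / 2))" using elim by (simp add: field_simps)
    finally show ?case by (simp only: exp_of_nat_mult)
  qed
  show "eventually (\<lambda>k. 0 \<le> (\<Prod>l<k. f l)) sequentially"
    by (intro always_eventually allI prod_nonneg) (simp add: assms(1) less_imp_le)
  show "(\<lambda>k. exp (L / 2) ^ k) \<longlonglongrightarrow> 0" using assms(3) by (intro LIMSEQ_realpow_zero) auto
qed auto

lemma prod_bounded_below_of_average_ln_pos: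
  fixes f :: "nat \<Rightarrow> real"
  assumes "\<And>l. 0 < f l" "(\<lambda>k. (\<Sum>l<k. ln (f l)) / real k) \<longlonglongrightarrow> L" "0 < L"
  shows "\<exists>m>0. \<forall>k. m \<le> (\<Prod>l<k. f l)"
proof -
  have "eventually (\<lambda>k. 0 < (\<Sum>l<k. ln (f l)) / real k) sequentially"
    using assms(2,3) by (intro order_tendstoD) auto
  then obtain k0 where k0: "\<And>k. k \<ge> k0 \<Longrightarrow> 0 < (\<Sum>l<k. ln (f l)) / real k"
    by (auto simp: eventually_sequentially)
  have P: "(\<Prod>l<k. f l) = exp (\<Sum>l<k. ln (f l))" for k by (simp add: exp_sum assms(1))
  let ?m = "Min (insert 1 ((\<lambda>k. \<Prod>l<k. f l) ` {..<k0}))"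
  have "0 < ?m" by (auto simp: P)
  moreover have "?m \<le> (\<Prod>l<k. f l)" for k
  proof (cases "k < k0")
    case True
    then show ?thesis by (intro Min_le) auto
  next
    case False
    then have "0 < (\<Sum>l<k. ln (f l))" using k0[of k] by (auto simp: zero_less_divide_iff)
    then have "1 \<le> (\<Prod>l<k. f l)" by (simp add: P)
    moreover have "?m \<le> 1" by (intro Min_le) auto
    ultimately show ?thesis by linarith
  qed
  ultimately show ?thesis by blast
qed

section \<open>The pressure function\<close>

locale ratio_vectors =
  fixes \<gamma> :: "'m::finite \<Rightarrow> nat \<Rightarrow> real" and q :: real
  assumes \<gamma>_pos: "0 < \<gamma> i j" and \<gamma>_le: "\<gamma> i j \<le> q" and q_less_1: "q < 1"
    and summable_\<gamma>: "summable (\<gamma> i)"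
begin

lemma q_pos: "0 < q"
  using \<gamma>_pos[of undefined 0] \<gamma>_le[of undefined 0] by linarith

lemma ln_q_neg: "ln q < 0"
  using q_pos q_less_1 by simp

lemma \<gamma>_less_1: "\<gamma> i j < 1"
  using \<gamma>_le[of i j] q_less_1 by linarith

lemma theta_index_le: "theta_index \<gamma> i \<le> theta \<gamma>"
  unfolding theta_def by (rule Max_ge) auto

lemma theta_index_set_nonempty: "{t. t > 0 \<and> summable (\<lambda>j. \<gamma> i j powr t)} \<noteq> {}"
proof -
  have "summable (\<lambda>j. \<gamma> i j powr 1)" using summable_\<gamma>[of i] \<gamma>_pos[of i] by (simp add: less_imp_le)
  then show ?thesis by (auto intro!: exI[of _ 1])
qed

lemma theta_nonneg: "0 \<le> theta \<gamma>"
proof -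
  have "0 \<le> theta_index \<gamma> undefined"
    unfolding theta_index_def by (rule cInf_greatest[OF theta_index_set_nonempty]) auto
  with theta_index_le[of undefined] show ?thesis by linarith
qed

lemma summable_powr:
  assumes "theta \<gamma> < t"
  shows "summable (\<lambda>j. \<gamma> i j powr t)"
proof -
  have "Inf {t. t > 0 \<and> summable (\<lambda>j. \<gamma> i j powr t)} < t"
    using theta_index_le[of i] assms by (simp add: theta_index_def)
  from cInf_lessD[OF theta_index_set_nonempty this]
  obtain s where s: "s < t" "summable (\<lambda>j. \<gamma> i j powr s)" by auto
  have "norm (\<gamma> i j powr t) \<le> \<gamma> i j powr s" for j
    using \<gamma>_pos[of i j] \<gamma>_less_1[of i j] s(1) by (simp add: powr_mono')
  then show ?thesis by (intro summable_comparison_test'[OF s(2), of 0])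
qed

lemma sum_powr_pos: "theta \<gamma> < t \<Longrightarrow> 0 < (\<Sum>j. \<gamma> i j powr t)"
  by (intro suminf_pos summable_powr) (simp_all add: \<gamma>_pos[THEN less_imp_neq, symmetric])

text \<open>
  Every ratio is at most \<open>q\<close>, so each pressure function decreases at least at the rate \<open>- ln q\<close>.
  This single estimate gives uniqueness of the zero, its existence, the nonvanishing of the
  derivative there and a bound on how far the zero moves with \<open>\<eta>\<close>.
\<close>
lemma pressure_add_le:
  assumes t: "theta \<gamma> < t" and h: "0 \<le> h" and \<eta>: "\<And>i. 0 \<le> \<eta> $ i" "(\<Sum>i\<in>UNIV. \<eta> $ i) = 1"
  shows "pressure \<gamma> \<eta> (t + h) \<le> pressure \<gamma> \<eta> t + h * ln q"
proof -
  have ln_le: "ln (\<Sum>j. \<gamma> i j powr (t + h)) \<le> ln (\<Sum>j. \<gamma> i j powr t) + h * ln q" for i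
  proof -
    have "(\<Sum>j. \<gamma> i j powr (t + h)) \<le> (\<Sum>j. q powr h * \<gamma> i j powr t)"
    proof (rule suminf_le)
      fix j
      have "\<gamma> i j powr h \<le> q powr h"
        using \<gamma>_pos[of i j] \<gamma>_le[of i j] h by (intro powr_mono2) auto
      then show "\<gamma> i j powr (t + h) \<le> q powr h * \<gamma> i j powr t"
        by (simp add: powr_add mult.commute[of "q powr h"] mult_left_mono)
      show "summable (\<lambda>j. \<gamma> i j powr (t + h))" using t h by (intro summable_powr) auto
      show "summable (\<lambda>j. q powr h * \<gamma> i j powr t)" by (intro summable_mult summable_powr t)
    qed
    also have "\<dots> = q powr h * (\<Sum>j. \<gamma> i j powr t)" by (rule suminf_mult[OF summable_powr[OF t]])
    finally have "ln (\<Sum>j. \<gamma> i j powr (t + h)) \<le> ln (q powr h * (\<Sum>j. \<gamma> i j powr t))"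
      using sum_powr_pos[of "t + h" i] t h by simp
    also have "\<dots> = ln (\<Sum>j. \<gamma> i j powr t) + h * ln q"
      using sum_powr_pos[OF t, of i] q_pos by (simp add: ln_mult)
    finally show ?thesis .
  qed
  have "pressure \<gamma> \<eta> (t + h) \<le> (\<Sum>i\<in>UNIV. \<eta> $ i * (ln (\<Sum>j. \<gamma> i j powr t) + h * ln q))"
    unfolding pressure_def by (intro sum_mono mult_left_mono ln_le \<eta>)
  also have "\<dots> = pressure \<gamma> \<eta> t + (\<Sum>i\<in>UNIV. \<eta> $ i) * (h * ln q)"
    by (simp add: pressure_def distrib_left sum.distrib sum_distrib_right)
  finally show ?thesis using \<eta>(2) by simp
qed

text \<open>
  Complex extensions to the half-plane \<open>theta \<gamma> < Re z\<close>, respectively to a neighbourhood of its real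
  points, on which the sums stay away from the branch cut of the logarithm.
\<close>
definition complex_sum :: "'m \<Rightarrow> complex \<Rightarrow> complex" where
  "complex_sum i z = (\<Sum>j. exp (of_real (ln (\<gamma> i j)) * z))"

definition complex_pressure :: "real ^ 'm \<Rightarrow> complex \<Rightarrow> complex" where
  "complex_pressure v z = (\<Sum>i\<in>UNIV. of_real (v $ i) * Ln (complex_sum i z))"

lemma complex_sum_of_real:
  assumes "theta \<gamma> < t"
  shows "complex_sum i (of_real t) = of_real (\<Sum>j. \<gamma> i j powr t)"
proof -
  have "exp (of_real (ln (\<gamma> i j)) * of_real t) = complex_of_real (\<gamma> i j powr t)" for j
    using \<gamma>_pos[of i j] by (simp add: powr_def exp_of_real mult.commute flip: of_real_mult)
  then show ?thesis using suminf_of_real[OF summable_powr[OF assms, of i], where 'a = complex]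
    by (simp add: complex_sum_def)
qed

lemma complex_pressure_of_real:
  assumes "theta \<gamma> < t"
  shows "complex_pressure v (of_real t) = of_real (pressure \<gamma> v t)"
  using sum_powr_pos[OF assms]
  by (simp add: complex_pressure_def pressure_def complex_sum_of_real[OF assms] Ln_of_real)

lemma holomorphic_complex_sum: "complex_sum i holomorphic_on {z. theta \<gamma> < Re z}"
proof (rule holomorphic_uniform_sequence)
  show "open {z. theta \<gamma> < Re z}" by (rule open_halfspace_Re_gt)
  show "(\<lambda>z. \<Sum>j<n. exp (of_real (ln (\<gamma> i j)) * z)) holomorphic_on {z. theta \<gamma> < Re z}" for n
    by (intro holomorphic_intros)
  fix z assume "z \<in> {z. theta \<gamma> < Re z}"
  define d where "d = (Re z - theta \<gamma>) / 2"
  have d: "0 < d" "theta \<gamma> < Re z - d" using \<open>z \<in> _\<close> by (auto simp: d_def field_simps)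
  have Re_ge: "Re z - d \<le> Re w" if "w \<in> cball z d" for w
    using abs_Re_le_cmod[of "z - w"] that by (auto simp: dist_norm)
  have "uniform_limit (cball z d) (\<lambda>n z. \<Sum>j<n. exp (of_real (ln (\<gamma> i j)) * z)) (complex_sum i) sequentially"
    unfolding complex_sum_def
  proof (rule Weierstrass_m_test[where M = "\<lambda>j. \<gamma> i j powr (Re z - d)"])
    fix j w assume w: "w \<in> cball z d"
    have "norm (exp (of_real (ln (\<gamma> i j)) * w)) = \<gamma> i j powr Re w"
      using \<gamma>_pos[of i j] by (simp add: powr_def mult.commute)
    also have "\<dots> \<le> \<gamma> i j powr (Re z - d)"
      using Re_ge[OF w] \<gamma>_pos[of i j] \<gamma>_less_1[of i j] by (intro powr_mono') auto
    finally show "norm (exp (of_real (ln (\<gamma> i j)) * w)) \<le> \<gamma> i j powr (Re z - d)" .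
  qed (rule summable_powr[OF d(2)])
  then show "\<exists>d>0. cball z d \<subseteq> {z. theta \<gamma> < Re z} \<and>
      uniform_limit (cball z d) (\<lambda>n z. \<Sum>j<n. exp (of_real (ln (\<gamma> i j)) * z)) (complex_sum i) sequentially"
    using d Re_ge by (intro exI[of _ d]) fastforce
qed

lemma holomorphic_complex_pressure:
  assumes "theta \<gamma> < D"
  shows "\<exists>R>0. \<forall>v. complex_pressure v holomorphic_on ball (of_real D) R"
proof -
  let ?H = "{z. theta \<gamma> < Re z}"
  let ?V = "\<lambda>i. ?H \<inter> complex_sum i -` {w. 0 < Re w}"
  have "open (?V i)" for i
    by (intro continuous_open_preimage holomorphic_on_imp_continuous_on
        holomorphic_complex_sum open_halfspace_Re_gt)
  then have "open (\<Inter>i. ?V i)" by (intro open_INT) auto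
  moreover have "of_real D \<in> (\<Inter>i. ?V i)"
    using assms sum_powr_pos[OF assms] by (simp add: complex_sum_of_real)
  ultimately obtain R where R: "R > 0" "ball (of_real D) R \<subseteq> (\<Inter>i. ?V i)"
    by (rule openE)
  have "complex_pressure v holomorphic_on ball (of_real D) R" for v
    unfolding complex_pressure_def using R(2)
    by (intro holomorphic_intros holomorphic_on_subset[OF holomorphic_complex_sum])
      (auto simp: complex_nonpos_Reals_iff subset_iff not_le)
  with R(1) show ?thesis by blast
qed

lemma continuous_on_pressure: "continuous_on {theta \<gamma><..} (pressure \<gamma> v)"
proof -
  have "isCont (pressure \<gamma> v) t" if t: "theta \<gamma> < t" for t
  proof -
    obtain R where R: "R > 0" "complex_pressure v holomorphic_on ball (of_real t) R"
      using holomorphic_complex_pressure[OF t] by blast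
    then have "isCont (complex_pressure v) (of_real t)"
      using holomorphic_on_imp_continuous_on continuous_on_eq_continuous_at[OF open_ball] centre_in_ball by blast
    then have "isCont (\<lambda>s. Re (complex_pressure v (of_real s))) t"
      by (intro continuous_intros isCont_o2[of t "\<lambda>s. complex_of_real s"]) auto
    moreover have "eventually (\<lambda>s. Re (complex_pressure v (of_real s)) = pressure \<gamma> v s) (nhds t)"
      using eventually_nhds_in_open[of "{theta \<gamma><..}" t] t
      by (auto simp: complex_pressure_of_real elim!: eventually_mono)
    ultimately show ?thesis by (simp add: isCont_cong)
  qed
  then show ?thesis by (intro continuous_at_imp_continuous_on) auto
qed

lemma pressure_zero_exists:
  assumes \<eta>: "\<And>i. 0 \<le> \<eta> $ i" "(\<Sum>i\<in>UNIV. \<eta> $ i) = 1" and u: "theta \<gamma> < u" "0 < pressure \<gamma> \<eta> u"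
  shows "\<exists>D>theta \<gamma>. pressure \<gamma> \<eta> D = 0"
proof -
  define h where "h = pressure \<gamma> \<eta> u / (- ln q)"
  have h: "0 \<le> h" "h * ln q = - pressure \<gamma> \<eta> u"
    using u(2) ln_q_neg by (auto simp: h_def divide_nonneg_neg less_imp_le)
  have "pressure \<gamma> \<eta> (u + h) \<le> 0" using pressure_add_le[where \<eta> = \<eta>, OF u(1) h(1) \<eta>] h(2) by simp
  moreover have "continuous_on {u..u + h} (pressure \<gamma> \<eta>)"
    by (rule continuous_on_subset[OF continuous_on_pressure]) (use u(1) in auto)
  ultimately obtain D where "u \<le> D" "pressure \<gamma> \<eta> D = 0"
    using IVT2'[of "pressure \<gamma> \<eta>" "u + h" 0 u] u(2) h(1) by (auto simp: less_imp_le)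
  with u(1) show ?thesis by (intro exI[of _ D]) auto
qed

lemma dist_pressure_zero_le:
  assumes \<eta>: "\<And>i. 0 \<le> \<eta> $ i" "(\<Sum>i\<in>UNIV. \<eta> $ i) = 1"
    and D: "theta \<gamma> < D" "pressure \<gamma> \<eta> D = 0" and t: "theta \<gamma> < t"
  shows "\<bar>D - t\<bar> * (- ln q) \<le> \<bar>pressure \<gamma> \<eta> t\<bar>"
proof (cases "t \<le> D")
  case True
  then show ?thesis using pressure_add_le[where \<eta> = \<eta>, OF t _ \<eta>, of "D - t"] D(2) by simp
next
  case False
  then show ?thesis using pressure_add_le[where \<eta> = \<eta>, OF D(1) _ \<eta>, of "t - D"] D(2) by simp
qed

text \<open>By \<open>pressure_add_le\<close> the right difference quotients along the real axis are at most \<open>ln q < 0\<close>.\<close>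
lemma deriv_complex_pressure_neq_0:
  assumes \<eta>: "\<And>i. 0 \<le> \<eta> $ i" "(\<Sum>i\<in>UNIV. \<eta> $ i) = 1" and D: "theta \<gamma> < D"
  shows "deriv (complex_pressure \<eta>) (of_real D) \<noteq> 0"
proof
  assume 0: "deriv (complex_pressure \<eta>) (of_real D) = 0"
  obtain R where R: "R > 0" "complex_pressure \<eta> holomorphic_on ball (of_real D) R"
    using holomorphic_complex_pressure[OF D] by blast
  then have "(complex_pressure \<eta> has_field_derivative 0) (at (of_real D))"
    using holomorphic_derivI[OF R(2) open_ball, of "of_real D" UNIV] 0 by simp
  then have "((\<lambda>w. (complex_pressure \<eta> (of_real D + w) - complex_pressure \<eta> (of_real D)) / w) \<longlongrightarrow> 0) (at 0)"
    by (simp add: DERIV_def)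
  moreover have "filterlim complex_of_real (at 0) (at_right 0)"
    unfolding filterlim_at by (auto intro!: tendsto_eq_intros simp: eventually_at_filter)
  ultimately have "((\<lambda>h. (complex_pressure \<eta> (of_real D + of_real h) - complex_pressure \<eta> (of_real D)) / of_real h) \<longlongrightarrow> 0) (at_right 0)"
    by (rule filterlim_compose)
  then have "((\<lambda>h. Re ((complex_pressure \<eta> (of_real D + of_real h) - complex_pressure \<eta> (of_real D)) / of_real h)) \<longlongrightarrow> Re 0) (at_right 0)"
    by (rule tendsto_Re)
  moreover have "eventually (\<lambda>h. Re ((complex_pressure \<eta> (of_real D + of_real h) - complex_pressure \<eta> (of_real D)) / of_real h) \<le> ln q) (at_right 0)"
    using eventually_at_right_less[of 0]
  proof eventually_elim
    case (elim h)
    have "complex_pressure \<eta> (of_real D + of_real h) = of_real (pressure \<gamma> \<eta> (D + h))"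
      using complex_pressure_of_real[of "D + h" \<eta>] D elim by simp
    then have "Re ((complex_pressure \<eta> (of_real D + of_real h) - complex_pressure \<eta> (of_real D)) / of_real h)
        = (pressure \<gamma> \<eta> (D + h) - pressure \<gamma> \<eta> D) / h"
      by (simp add: complex_pressure_of_real[OF D] flip: of_real_diff of_real_divide)
    also have "\<dots> \<le> ln q"
      using pressure_add_le[where \<eta> = \<eta>, OF D less_imp_le[OF elim] \<eta>] elim by (simp add: field_simps)
    finally show ?case .
  qed
  ultimately have "Re 0 \<le> ln q" by (rule tendsto_upperbound) (simp add: trivial_limit_at_right_real)
  with ln_q_neg show False by simp
qed

section \<open>The dimension as a zero of the pressure\<close>

text \<open>
  Along \<open>\<omega>\<close> the logarithm of the product of the first \<open>k\<close> level sums grows like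
  \<open>k * pressure \<gamma> \<eta> s\<close>. Hence the natural covers have vanishing \<open>s\<close>-weight when the pressure is
  negative. When it is positive it stays so after discarding all but finitely many letters,
  and then the ratios are bounded below, as the mass distribution argument requires.
\<close>
theorem hausdorff_dim_moran_fractal:
  fixes J :: "'a::euclidean_space set"
  assumes a: "inj a" and \<omega>: "\<omega> \<in> freq_seqs a \<eta>"
    and \<eta>: "\<And>i. 0 \<le> \<eta> $ i" "(\<Sum>i\<in>UNIV. \<eta> $ i) = 1"
    and J: "compact J" "interior J \<noteq> {}" "diameter J = 1" and E: "moran_fractal a \<gamma> J \<omega> E"
    and D: "theta \<gamma> < D" "pressure \<gamma> \<eta> D = 0"
  shows "hausdorff_dim E = ennreal D"
proof -
  from E obtain K where K: "admissible a \<gamma> J \<omega> K" and E_eq: "E = (\<Union>\<sigma>. \<Inter>i\<in>{1..}. K (map \<sigma> [0..<i]))"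
    by (auto simp: moran_fractal_def)
  define c where "c = (\<lambda>n. \<gamma> (inv a (\<omega> n)))"
  have inv: "\<omega> l = a (inv a (\<omega> l))" for l
    using \<omega> by (intro f_inv_into_f[symmetric]) (auto simp: freq_seqs_def)
  interpret moran_construction c q J K
  proof
    fix \<sigma> j
    have ratio: "diameter (K (\<sigma> @ [j])) / diameter (K \<sigma>) = c (length \<sigma>) j" for \<sigma> j
      using K inv[of "length \<sigma>"] by (simp add: admissible_def c_def)
    show "diameter (K (\<sigma> @ [j])) = c (length \<sigma>) j * diameter (K \<sigma>)"
    proof -
      have "diameter (K \<sigma>) \<noteq> 0" using ratio[of \<sigma> j] \<gamma>_pos by (auto simp: c_def less_imp_neq)
      then show ?thesis using ratio[of \<sigma> j] by (simp add: field_simps)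
    qed
  qed (use K J \<gamma>_pos \<gamma>_le q_less_1 in \<open>auto simp: admissible_def c_def\<close>)
  have E_limit: "E = limit_set" by (simp add: E_eq limit_set_def)
  have growth: "(\<lambda>k. (\<Sum>l<k. ln (f (inv a (\<omega> l)))) / real k) \<longlonglongrightarrow> (\<Sum>i\<in>UNIV. \<eta> $ i * ln (f i))" for f
    by (rule freq_seqs_average[OF a \<omega>])
  show ?thesis
    unfolding E_limit
  proof (rule hausdorff_dim_eqI[OF theta_nonneg D(1)])
    fix s assume "D < s"
    then have s: "theta \<gamma> < s" using D by simp
    have "pressure \<gamma> \<eta> s \<le> (s - D) * ln q"
      using pressure_add_le[where \<eta> = \<eta>, OF D(1) _ \<eta>, of "s - D"] D(2) \<open>D < s\<close> by simp
    also have "\<dots> < 0" using \<open>D < s\<close> ln_q_neg by (simp add: mult_pos_neg)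
    finally have neg: "pressure \<gamma> \<eta> s < 0" .
    show "hausdorff_measure s limit_set = 0"
    proof (rule hausdorff_measure_limit_set_eq_0)
      show "0 < s" using s theta_nonneg by linarith
      show "summable (\<lambda>j. c n j powr s)" for n unfolding c_def by (rule summable_powr[OF s])
      show "(\<lambda>k. \<Prod>l<k. \<Sum>j. c l j powr s) \<longlonglongrightarrow> 0"
        unfolding c_def
        by (rule prod_tendsto_0_of_average_ln_neg[OF sum_powr_pos[OF s] growth])
          (use neg in \<open>simp add: pressure_def\<close>)
    qed
  next
    fix s assume s: "theta \<gamma> < s" "s < D"
    have "0 < (D - s) * (- ln q)" using s ln_q_neg by (intro mult_pos_pos) auto
    then have pos: "0 < pressure \<gamma> \<eta> s"
      using pressure_add_le[where \<eta> = \<eta>, OF s(1) _ \<eta>, of "D - s"] D(2) s(2) by simp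
    have "(\<lambda>N. \<Sum>i\<in>UNIV. \<eta> $ i * ln (\<Sum>j<N. \<gamma> i j powr s)) \<longlonglongrightarrow> pressure \<gamma> \<eta> s"
      unfolding pressure_def using less_imp_neq[OF sum_powr_pos[OF s(1)]]
      by (intro tendsto_intros summable_LIMSEQ summable_powr s) auto
    then have "eventually (\<lambda>N. 0 < (\<Sum>i\<in>UNIV. \<eta> $ i * ln (\<Sum>j<N. \<gamma> i j powr s))) sequentially"
      using pos by (rule order_tendstoD)
    from eventually_happens'[OF sequentially_bot eventually_conj[OF this eventually_gt_at_top[of 0]]]
    obtain N where N: "0 < (\<Sum>i\<in>UNIV. \<eta> $ i * ln (\<Sum>j<N. \<gamma> i j powr s))" "0 < N" by blast
    have "0 < (\<Sum>j<N. \<gamma> i j powr s)" for i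
      using N(2) less_imp_neq[OF \<gamma>_pos] by (intro sum_pos) auto
    from prod_bounded_below_of_average_ln_pos[OF this growth N(1)]
    obtain m where m: "0 < m" "\<And>k. m \<le> (\<Prod>l<k. \<Sum>j<N. c l j powr s)"
      by (auto simp: c_def)
    define \<kappa> where "\<kappa> = Min ((\<lambda>(i, j). \<gamma> i j) ` (UNIV \<times> {..<N}))"
    show "hausdorff_measure s limit_set \<noteq> 0"
    proof (rule hausdorff_measure_limit_set_neq_0[OF _ _ _ m])
      show "0 < s" using s theta_nonneg by linarith
      show "0 < \<kappa>" unfolding \<kappa>_def using N(2) \<gamma>_pos by (subst Min_gr_iff) auto
      show "\<kappa> \<le> c n j" if "j < N" for n j
        unfolding \<kappa>_def c_def using that by (intro Min_le) auto
    qed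
  qed
qed

end

section \<open>An analytic implicit function theorem\<close>

lemma power_sum_eq_sum_words:
  fixes x :: "'b \<Rightarrow> 'a::comm_semiring_1"
  assumes "finite B"
  shows "(\<Sum>b\<in>B. x b) ^ n = (\<Sum>w\<in>{w. set w \<subseteq> B \<and> length w = n}. prod_list (map x w))"
proof (induction n)
  case 0
  have "{w. set w \<subseteq> B \<and> length w = 0} = {[]}" by auto
  then show ?case by simp
next
  case (Suc n)
  let ?W = "\<lambda>n. {w. set w \<subseteq> B \<and> length w = n}"
  have "?W (Suc n) = (\<lambda>(b, w). b # w) ` (B \<times> ?W n)"
    by (auto simp: length_Suc_conv)
  moreover have "inj_on (\<lambda>(b, w). b # w) (B \<times> ?W n)" by (auto simp: inj_on_def)
  ultimately have "(\<Sum>w\<in>?W (Suc n). prod_list (map x w))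
      = (\<Sum>(b, w)\<in>B \<times> ?W n. x b * prod_list (map x w))"
    by (simp add: sum.reindex case_prod_unfold)
  also have "\<dots> = (\<Sum>b\<in>B. x b) * (\<Sum>w\<in>?W n. prod_list (map x w))"
    by (simp add: sum.cartesian_product[symmetric] sum_product)
  finally show ?case using Suc by simp
qed

lemma prod_list_map_eq_prod_power_count_list:
  fixes x :: "'b \<Rightarrow> 'a::comm_semiring_1"
  assumes "finite B" "set w \<subseteq> B"
  shows "prod_list (map x w) = (\<Prod>b\<in>B. x b ^ count_list w b)"
  using assms(2)
proof (induction w)
  case (Cons a w)
  have "(\<Prod>b\<in>B. x b ^ count_list (a # w) b)
      = (\<Prod>b\<in>B. (if b = a then x b else 1) * x b ^ count_list w b)"
    by (intro prod.cong) auto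
  also have "\<dots> = x a * (\<Prod>b\<in>B. x b ^ count_list w b)"
    using Cons.prems assms(1) by (simp add: prod.distrib)
  finally show ?case using Cons by simp
qed simp

text \<open>
  Expanding powers of a linear form gives a series over words in the letters \<open>B\<close>. Words with the
  same letter counts carry the same monomial, and only finitely many words share given counts, so
  collecting them yields a power series over multi-indices; no multinomial coefficient is needed.
\<close>
lemma word_series_imp_power_series:
  fixes D :: "'b list \<Rightarrow> real"
  assumes B: "finite B" and D: "\<And>w. set w \<subseteq> B \<Longrightarrow> \<bar>D w\<bar> \<le> C * K ^ length w"
    and "0 \<le> K" and r: "r > 0" "real (card B) * (K * r) < 1"
  shows "\<exists>c. \<forall>t s. (\<forall>b\<in>B. \<bar>t b\<bar> < r) \<longrightarrow>
       (\<lambda>n. \<Sum>w\<in>{w. set w \<subseteq> B \<and> length w = n}. D w * prod_list (map t w)) sums s \<longrightarrow>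
       ((\<lambda>\<alpha>. c \<alpha> * (\<Prod>b\<in>B. t b ^ \<alpha> b)) has_sum s) (B \<rightarrow>\<^sub>E UNIV)"
proof (intro exI allI impI)
  let ?W = "\<lambda>n. {w. set w \<subseteq> B \<and> length w = n}"
  let ?fib = "\<lambda>\<alpha>. {w. set w \<subseteq> B \<and> restrict (count_list w) B = \<alpha>}"
  define c where "c = (\<lambda>\<alpha>. \<Sum>w\<in>?fib \<alpha>. D w)"
  fix t :: "'b \<Rightarrow> real" and s
  assume t: "\<forall>b\<in>B. \<bar>t b\<bar> < r"
    and s: "(\<lambda>n. \<Sum>w\<in>?W n. D w * prod_list (map t w)) sums s"
  have finW: "finite (?W n)" for n by (rule finite_lists_length_eq[OF B])
  have cardW: "real (card (?W n)) = real (card B) ^ n" for n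
    by (simp add: card_lists_length_eq[OF B])
  have C0: "0 \<le> C" using D[of "[]"] by simp
  have bound: "\<bar>D w * prod_list (map t w)\<bar> \<le> C * (K * r) ^ n" if "w \<in> ?W n" for n w
  proof -
    have "\<bar>prod_list (map t w)\<bar> \<le> r ^ length w" if "set w \<subseteq> B"
      using that
    proof (induction w)
      case (Cons a w)
      have "\<bar>t a\<bar> \<le> r" using Cons.prems t by (auto intro: less_imp_le)
      moreover have "\<bar>prod_list (map t w)\<bar> \<le> r ^ length w" using Cons by simp
      ultimately have "\<bar>t a\<bar> * \<bar>prod_list (map t w)\<bar> \<le> r * r ^ length w"
        using r(1) by (intro mult_mono) auto
      then show ?case by (simp add: abs_mult)
    qed simp
    then have "\<bar>D w\<bar> * \<bar>prod_list (map t w)\<bar> \<le> (C * K ^ n) * r ^ n"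
      using D[of w] that C0 \<open>0 \<le> K\<close> by (auto intro!: mult_mono)
    then show ?thesis by (simp add: abs_mult power_mult_distrib mult_ac)
  qed
  have sumbound: "(\<Sum>w\<in>?W n. \<bar>D w * prod_list (map t w)\<bar>) \<le> C * (real (card B) * (K * r)) ^ n" for n
  proof -
    have "(\<Sum>w\<in>?W n. \<bar>D w * prod_list (map t w)\<bar>) \<le> (\<Sum>w\<in>?W n. C * (K * r) ^ n)"
      by (intro sum_mono bound)
    then show ?thesis by (simp add: cardW power_mult_distrib mult_ac)
  qed
  have geo: "summable (\<lambda>n. C * (real (card B) * (K * r)) ^ n)"
    using r \<open>0 \<le> K\<close> by (intro summable_mult summable_geometric) auto
  have abs_sum: "(\<lambda>n. \<Sum>w\<in>?W n. \<bar>D w * prod_list (map t w)\<bar>) summable_on UNIV"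
  proof (rule norm_summable_imp_summable_on)
    show "summable (\<lambda>n. norm (\<Sum>w\<in>?W n. \<bar>D w * prod_list (map t w)\<bar>))"
      using sumbound by (intro summable_comparison_test'[OF geo, of 0]) (auto simp: sum_nonneg)
  qed
  have "(\<lambda>x. norm (case x of (n, w) \<Rightarrow> D w * prod_list (map t w))) summable_on Sigma UNIV ?W"
    by (rule summable_on_SigmaI[OF _ abs_sum]) (auto intro!: has_sum_finite finW)
  then have summ: "(\<lambda>(n, w). D w * prod_list (map t w)) summable_on Sigma UNIV ?W"
    by (rule abs_summable_summable)
  have "((\<lambda>n. \<Sum>w\<in>?W n. D w * prod_list (map t w)) has_sum s) UNIV"
  proof (rule norm_summable_imp_has_sum[OF _ s])
    have "\<bar>\<Sum>w\<in>?W n. D w * prod_list (map t w)\<bar> \<le> C * (real (card B) * (K * r)) ^ n" for n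
      using order_trans[OF sum_abs sumbound] .
    then show "summable (\<lambda>n. norm (\<Sum>w\<in>?W n. D w * prod_list (map t w)))"
      by (intro summable_comparison_test'[OF geo, of 0]) auto
  qed
  then have "((\<lambda>(n, w). D w * prod_list (map t w)) has_sum s) (Sigma UNIV ?W)"
    by (intro has_sum_SigmaI[OF _ _ summ]) (auto intro!: has_sum_finite finW)
  \<comment> \<open>The pairs (length, word) and (letter counts, word) both just index the words, so the sum
    can be regrouped from lengths to letter counts.\<close>
  also have "?this \<longleftrightarrow> ((\<lambda>(\<alpha>, w). D w * prod_list (map t w)) has_sum s) (Sigma (B \<rightarrow>\<^sub>E UNIV) ?fib)"
    by (rule has_sum_reindex_bij_witness
          [of _ "\<lambda>(\<alpha>, w). (length w, w)" "\<lambda>(n, w). (restrict (count_list w) B, w)"]) auto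
  finally have big: "((\<lambda>(\<alpha>, w). D w * prod_list (map t w)) has_sum s) (Sigma (B \<rightarrow>\<^sub>E UNIV) ?fib)" .
  show "((\<lambda>\<alpha>. c \<alpha> * (\<Prod>b\<in>B. t b ^ \<alpha> b)) has_sum s) (B \<rightarrow>\<^sub>E UNIV)"
  proof (rule has_sum_SigmaD[OF big])
    fix \<alpha> assume "\<alpha> \<in> B \<rightarrow>\<^sub>E (UNIV :: nat set)"
    have len: "length w = (\<Sum>b\<in>B. \<alpha> b)" if "w \<in> ?fib \<alpha>" for w
    proof -
      have "(\<Sum>b\<in>B. \<alpha> b) = (\<Sum>b\<in>B. count_list w b)"
        using that by (intro sum.cong) auto
      also have "\<dots> = (\<Sum>b\<in>set w. count_list w b)"
        using that B by (intro sum.mono_neutral_right) (auto simp: count_list_0_iff)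
      finally show ?thesis by (simp add: sum_count_set)
    qed
    then have "?fib \<alpha> \<subseteq> ?W (\<Sum>b\<in>B. \<alpha> b)" by auto
    then have fin: "finite (?fib \<alpha>)" by (rule finite_subset[OF _ finW])
    have "prod_list (map t w) = (\<Prod>b\<in>B. t b ^ \<alpha> b)" if "w \<in> ?fib \<alpha>" for w
    proof -
      have "prod_list (map t w) = (\<Prod>b\<in>B. t b ^ count_list w b)"
        using that by (intro prod_list_map_eq_prod_power_count_list B) auto
      then show ?thesis using that by auto
    qed
    then have "(\<Sum>w\<in>?fib \<alpha>. D w * prod_list (map t w)) = c \<alpha> * (\<Prod>b\<in>B. t b ^ \<alpha> b)"
      by (simp add: c_def sum_distrib_right)
    then show "((\<lambda>w. case (\<alpha>, w) of (\<alpha>, w) \<Rightarrow> D w * prod_list (map t w)) has_sum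
        c \<alpha> * (\<Prod>b\<in>B. t b ^ \<alpha> b)) (?fib \<alpha>)"
      using fin by (auto intro!: has_sum_finiteI)
  qed
qed

text \<open>
  Dividing out the zero, \<open>F z = (z - \<zeta>) G z\<close>, the integrand becomes \<open>k z / (z - \<zeta>)\<close> with \<open>k\<close>
  holomorphic and \<open>k \<zeta> = \<zeta> - a\<close>, so that Cauchy's integral formula applies.
\<close>
lemma contour_integral_log_derivative_simple_zero:
  assumes F: "F holomorphic_on ball a R" and R: "\<epsilon> < R"
    and \<zeta>: "\<zeta> \<in> ball a \<epsilon>" "F \<zeta> = 0" "deriv F \<zeta> \<noteq> 0"
    and nz: "\<And>z. z \<in> cball a \<epsilon> \<Longrightarrow> z \<noteq> \<zeta> \<Longrightarrow> F z \<noteq> 0"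
  shows "((\<lambda>z. (z - a) * (deriv F z / F z)) has_contour_integral (2 * of_real pi * \<i> * (\<zeta> - a)))
           (circlepath a \<epsilon>)"
proof -
  have eps: "\<epsilon> > 0" using \<zeta>(1) order_le_less_trans[OF zero_le_dist[of a \<zeta>]] by simp
  define G where "G = (\<lambda>z. if z = \<zeta> then deriv F \<zeta> else (F z - F \<zeta>) / (z - \<zeta>))"
  have G: "G holomorphic_on ball a R"
    unfolding G_def by (rule pole_lemma_open[OF F]) auto
  have FG: "F z = (z - \<zeta>) * G z" for z using \<zeta>(2) by (auto simp: G_def)
  have Gnz: "G z \<noteq> 0" if "z \<in> cball a \<epsilon>" for z
    using nz[OF that] \<zeta>(2,3) by (cases "z = \<zeta>") (simp_all add: G_def)
  define k where "k = (\<lambda>z. (z - a) * (1 + (z - \<zeta>) * (deriv G z / G z)))"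
  have sub: "cball a \<epsilon> \<subseteq> ball a R" using R by auto
  have k: "k holomorphic_on cball a \<epsilon>"
    unfolding k_def using Gnz
    by (intro holomorphic_intros holomorphic_on_subset[OF G sub]
        holomorphic_on_subset[OF holomorphic_deriv[OF G] sub]) auto
  have dF: "deriv F z = G z + (z - \<zeta>) * deriv G z" if "z \<in> ball a R" for z
  proof -
    have "(G has_field_derivative deriv G z) (at z)"
      using G that by (meson holomorphic_derivI open_ball)
    then have "((\<lambda>z. (z - \<zeta>) * G z) has_field_derivative (G z + (z - \<zeta>) * deriv G z)) (at z)"
      by (auto intro!: derivative_eq_intros)
    moreover have "F = (\<lambda>z. (z - \<zeta>) * G z)" using FG by auto
    ultimately show ?thesis by (simp add: DERIV_imp_deriv)
  qed
  have "((\<lambda>z. k z / (z - \<zeta>)) has_contour_integral (2 * of_real pi * \<i> * k \<zeta>)) (circlepath a \<epsilon>)"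
    using \<zeta>(1) by (intro Cauchy_integral_circlepath holomorphic_on_imp_continuous_on[OF k]
        holomorphic_on_subset[OF k ball_subset_cball]) (simp add: dist_norm norm_minus_commute)
  moreover have "k \<zeta> = \<zeta> - a" by (simp add: k_def)
  ultimately have "((\<lambda>z. k z / (z - \<zeta>)) has_contour_integral (2 * of_real pi * \<i> * (\<zeta> - a))) (circlepath a \<epsilon>)"
    by simp
  then show ?thesis
  proof (rule has_contour_integral_eq)
    fix z assume "z \<in> path_image (circlepath a \<epsilon>)"
    then have z: "z \<in> cball a \<epsilon>" "z \<in> ball a R" "z \<noteq> \<zeta>" using eps R \<zeta>(1) by (auto simp: dist_commute)
    show "k z / (z - \<zeta>) = (z - a) * (deriv F z / F z)"
      using z Gnz[OF z(1)] by (simp add: k_def dF FG field_simps)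
  qed
qed

text \<open>
  The residue formula for the displacement \<open>\<zeta> - a\<close> of a simple zero, integrated by parts. Passing
  from the logarithmic derivative to the logarithm removes all derivatives, so that what is left
  is the power series of \<open>ln (1 + q)\<close>.
\<close>
lemma contour_integral_Ln_perturbation:
  assumes p: "p holomorphic_on ball a R" and u: "u holomorphic_on ball a R"
    and R: "0 < \<epsilon>" "\<epsilon> < R"
    and a: "p a = 0" "deriv p a \<noteq> 0" "\<And>z. z \<in> cball a \<epsilon> \<Longrightarrow> z \<noteq> a \<Longrightarrow> p z \<noteq> 0"
    and \<zeta>: "\<zeta> \<in> ball a \<epsilon>" "p \<zeta> + u \<zeta> = 0" "deriv (\<lambda>z. p z + u z) \<zeta> \<noteq> 0"
      "\<And>z. z \<in> cball a \<epsilon> \<Longrightarrow> z \<noteq> \<zeta> \<Longrightarrow> p z + u z \<noteq> 0"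
    and small: "\<And>z. z \<in> sphere a \<epsilon> \<Longrightarrow> norm (u z) < norm (p z)"
  shows "((\<lambda>z. Ln (1 + u z / p z)) has_contour_integral - (2 * of_real pi * \<i> * (\<zeta> - a)))
           (circlepath a \<epsilon>)"
proof -
  let ?F = "\<lambda>z. p z + u z" and ?q = "\<lambda>z. u z / p z"
  have F: "?F holomorphic_on ball a R" by (intro holomorphic_intros p u)
  have 1: "((\<lambda>z. (z - a) * (deriv ?F z / ?F z)) has_contour_integral (2 * of_real pi * \<i> * (\<zeta> - a)))
           (circlepath a \<epsilon>)"
    by (rule contour_integral_log_derivative_simple_zero[OF F R(2) \<zeta>])
  have 2: "((\<lambda>z. (z - a) * (deriv p z / p z)) has_contour_integral (2 * of_real pi * \<i> * (a - a)))
           (circlepath a \<epsilon>)"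
    using R a by (intro contour_integral_log_derivative_simple_zero[OF p]) auto
  have "((\<lambda>z. Ln (1 + ?q z) + (z - a) * (deriv ?F z / ?F z - deriv p z / p z)) has_contour_integral 0)
          (circlepath a \<epsilon>)"
  proof -
    have "((\<lambda>z. Ln (1 + ?q z) + (z - a) * (deriv ?F z / ?F z - deriv p z / p z)) has_contour_integral
       ((\<lambda>z. (z - a) * Ln (1 + ?q z)) (pathfinish (circlepath a \<epsilon>)) - (\<lambda>z. (z - a) * Ln (1 + ?q z)) (pathstart (circlepath a \<epsilon>))))
       (circlepath a \<epsilon>)"
    proof (rule contour_integral_primitive[where S = "sphere a \<epsilon>"])
      fix z assume z: "z \<in> sphere a \<epsilon>"
      then have zR: "z \<in> ball a R" and pz: "p z \<noteq> 0" and Fz: "?F z \<noteq> 0"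
        using R small[OF z] by (auto simp: add_eq_0_iff2)
      have dp: "(p has_field_derivative deriv p z) (at z)" and du: "(u has_field_derivative deriv u z) (at z)"
        using p u zR by (meson holomorphic_derivI open_ball)+
      have dF: "deriv ?F z = deriv p z + deriv u z"
        by (intro DERIV_imp_deriv derivative_intros dp du)
      have "norm (?q z) < 1" using small[OF z] pz by (simp add: norm_divide)
      then have nn: "1 + ?q z \<notin> \<real>\<^sub>\<le>\<^sub>0"
      proof -
        have "Re (?q z) > -1" using \<open>norm (?q z) < 1\<close> abs_Re_le_cmod[of "?q z"] by linarith
        then show ?thesis by (auto simp: complex_nonpos_Reals_iff)
      qed
      have e1: "1 + ?q z = ?F z / p z" using pz by (simp add: field_simps)
      \<comment> \<open>\<open>1 + q = F / p\<close>, so the logarithmic derivative of \<open>1 + q\<close> is the difference of those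
        of \<open>F\<close> and \<open>p\<close>.\<close>
      have dq: "((\<lambda>z. 1 + ?q z) has_field_derivative (deriv u z * p z - u z * deriv p z) / (p z * p z)) (at z)"
        using DERIV_add[OF DERIV_const DERIV_divide[OF du dp pz]] by simp
      have "((\<lambda>z. Ln (1 + ?q z)) has_field_derivative
          inverse (1 + ?q z) * ((deriv u z * p z - u z * deriv p z) / (p z * p z))) (at z)"
        by (rule DERIV_chain2[OF has_field_derivative_Ln[OF nn] dq])
      from DERIV_mult[OF DERIV_diff[OF DERIV_ident DERIV_const[of a]] this]
      have "((\<lambda>z. (z - a) * Ln (1 + ?q z)) has_field_derivative
         (Ln (1 + ?q z) + (z - a) * (((deriv u z * p z - u z * deriv p z) / (p z * p z)) / (1 + ?q z)))) (at z)"
        by (simp add: divide_inverse mult_ac)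
      also have "((deriv u z * p z - u z * deriv p z) / (p z * p z)) / (1 + ?q z) = deriv ?F z / ?F z - deriv p z / p z"
      proof -
        have "((deriv u z * p z - u z * deriv p z) / (p z * p z)) / (?F z / p z)
            = (deriv u z * p z - u z * deriv p z) / (?F z * p z)"
          using pz by simp
        also have "\<dots> = (deriv p z + deriv u z) / ?F z - deriv p z / p z"
          using pz Fz by (simp add: diff_frac_eq algebra_simps)
        finally show ?thesis unfolding e1 dF .
      qed
      finally show "((\<lambda>z. (z - a) * Ln (1 + ?q z)) has_field_derivative
         (Ln (1 + ?q z) + (z - a) * (deriv ?F z / ?F z - deriv p z / p z))) (at z within sphere a \<epsilon>)"
        by (rule DERIV_subset) auto
    qed (use R in auto)
    then show ?thesis by simp
  qed
  from has_contour_integral_add[OF has_contour_integral_diff[OF this 1] 2]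
  show ?thesis by (simp add: algebra_simps)
qed


text \<open>
  A quantitative form of local injectivity. It controls all zeros in the disc at once and shows
  that a zero stays unique under small perturbations, which takes the place of Rouche's theorem.
\<close>
lemma norm_diff_ge_of_deriv_close:
  fixes f :: "complex \<Rightarrow> complex"
  assumes "\<And>z. z \<in> S \<Longrightarrow> (f has_field_derivative f' z) (at z)" and "convex S"
    and "\<And>z. z \<in> S \<Longrightarrow> norm (f' z - l) \<le> k" and "z \<in> S" "w \<in> S"
  shows "(norm l - k) * norm (z - w) \<le> norm (f z - f w)"
proof -
  have "norm ((f z - l * z) - (f w - l * w)) \<le> k * norm (z - w)"
  proof (rule field_differentiable_bound[OF \<open>convex S\<close>, where f' = "\<lambda>z. f' z - l"])
    fix x assume "x \<in> S"
    show "((\<lambda>z. f z - l * z) has_field_derivative f' x - l) (at x within S)"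
      using DERIV_subset[OF assms(1)[OF \<open>x \<in> S\<close>]] by (auto intro!: derivative_eq_intros)
  qed (use assms in auto)
  moreover have "norm (l * (z - w)) \<le> norm (f z - f w) + norm ((f z - l * z) - (f w - l * w))"
    by (rule order_trans[OF _ norm_triangle_ineq4]) (simp add: algebra_simps)
  ultimately have "norm l * norm (z - w) \<le> norm (f z - f w) + k * norm (z - w)"
    by (simp add: norm_mult)
  then show ?thesis by (simp add: algebra_simps)
qed

text \<open>
  The coefficient of the word \<open>w\<close> of length \<open>n > 0\<close> is, up to the factor \<open>(- 1)\<^sup>n / n\<close> from the
  logarithm and the factor \<open>1 / (2 \<pi> \<i>)\<close>, the integral over a fixed circle of the product of
  \<open>h\<^sub>b / p\<close> over the letters \<open>b\<close> of \<open>w\<close>. These integrals do not involve \<open>t\<close> and grow at most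
  geometrically with the length of \<open>w\<close>.
\<close>
theorem analytic_implicit_function:
  fixes p :: "complex \<Rightarrow> complex" and h :: "'b \<Rightarrow> complex \<Rightarrow> complex" and a :: complex
  assumes B: "finite B" and R: "R > 0"
    and p: "p holomorphic_on ball a R" and h: "\<And>b. b \<in> B \<Longrightarrow> h b holomorphic_on ball a R"
    and a: "p a = 0" "deriv p a \<noteq> 0"
  shows "\<exists>\<epsilon>>0. \<exists>r>0. \<exists>c :: ('b \<Rightarrow> nat) \<Rightarrow> real. \<forall>t \<zeta>. (\<forall>b\<in>B. \<bar>t b\<bar> < r) \<longrightarrow> \<zeta> \<in> ball a \<epsilon> \<longrightarrow>
       p \<zeta> + (\<Sum>b\<in>B. of_real (t b) * h b \<zeta>) = 0 \<longrightarrow>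
       ((\<lambda>\<alpha>. c \<alpha> * (\<Prod>b\<in>B. t b ^ \<alpha> b)) has_sum Re \<zeta>) (B \<rightarrow>\<^sub>E UNIV)"
proof -
  define \<kappa> where "\<kappa> = norm (deriv p a)"
  have \<kappa>: "\<kappa> > 0" using a by (simp add: \<kappa>_def)
  define N where "N = real (card B)"
  have N0: "N \<ge> 0" by (simp add: N_def)
  have der: "(f has_field_derivative deriv f z) (at z)" if "f holomorphic_on ball a R" "z \<in> ball a R" for f z
    using that by (meson holomorphic_derivI open_ball)
  have hd: "(\<lambda>z. deriv f z) holomorphic_on ball a R" if "f holomorphic_on ball a R" for f
    using that by (simp add: holomorphic_deriv)
  obtain \<epsilon> where \<epsilon>: "0 < \<epsilon>" "\<epsilon> < R" "\<And>z. z \<in> cball a \<epsilon> \<Longrightarrow> norm (deriv p z - deriv p a) \<le> \<kappa> / 4"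
  proof -
    have "isCont (deriv p) a"
      using holomorphic_on_imp_continuous_on[OF hd[OF p]] R by (simp add: continuous_on_eq_continuous_at)
    then obtain d where "d > 0" "\<And>z. dist z a < d \<Longrightarrow> dist (deriv p z) (deriv p a) < \<kappa> / 4"
      unfolding continuous_at_eps_delta using \<kappa> by (meson divide_pos_pos zero_less_numeral)
    then show ?thesis using R
      by (intro that[of "min d R / 2"]) (auto simp: dist_norm norm_minus_commute intro!: less_imp_le)
  qed
  have sub: "cball a \<epsilon> \<subseteq> ball a R" using \<epsilon> by auto
  have bnd: "\<exists>H. \<forall>z\<in>cball a \<epsilon>. norm (f z) \<le> H" if "f holomorphic_on ball a R" for f
  proof -
    have "bounded (f ` cball a \<epsilon>)"
      by (intro compact_imp_bounded compact_continuous_image compact_cball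
          holomorphic_on_imp_continuous_on holomorphic_on_subset[OF that sub])
    then show ?thesis by (auto simp: bounded_iff)
  qed
  have "\<forall>b\<in>B. \<exists>H. \<forall>z\<in>cball a \<epsilon>. norm (h b z) \<le> H \<and> norm (deriv (h b) z) \<le> H"
    using bnd[OF h] bnd[OF hd[OF h]] by (meson max.coboundedI1 max.coboundedI2)
  from bchoice[OF this] obtain Hf where
    Hf: "\<And>b z. b \<in> B \<Longrightarrow> z \<in> cball a \<epsilon> \<Longrightarrow> norm (h b z) \<le> Hf b \<and> norm (deriv (h b) z) \<le> Hf b"
    by blast
  define H where "H = 1 + (\<Sum>b\<in>B. \<bar>Hf b\<bar>)"
  have H: "H > 0" by (simp add: H_def add_pos_nonneg sum_nonneg)
  have hH: "norm (h b z) \<le> H" "norm (deriv (h b) z) \<le> H" if "b \<in> B" "z \<in> cball a \<epsilon>" for b z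
  proof -
    have "Hf b \<le> H" using member_le_sum[OF that(1), of "\<lambda>b. \<bar>Hf b\<bar>"] B by (simp add: H_def)
    then show "norm (h b z) \<le> H" "norm (deriv (h b) z) \<le> H" using Hf[OF that] by auto
  qed
  have p_ge: "3/4 * \<kappa> * norm (z - a) \<le> norm (p z)" if "z \<in> cball a \<epsilon>" for z
    using norm_diff_ge_of_deriv_close[of "cball a \<epsilon>" p "deriv p" "deriv p a" "\<kappa> / 4" z a]
      der[OF p] sub \<epsilon> that a by (auto simp: \<kappa>_def)
  define K where "K = H / (3/4 * \<kappa> * \<epsilon>)"
  have K: "K > 0" using H \<kappa> \<epsilon> by (simp add: K_def)
  \<comment> \<open>The first bound makes the perturbation quotient at most \<open>1/2\<close> on the circle, the second keeps
    the derivative of the perturbed function within \<open>\<kappa> / 2\<close> of \<open>deriv p a\<close>.\<close>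
  define r where "r = min (1 / (2 * K * (N + 1))) (\<kappa> / (4 * H * (N + 1)))"
  have r: "r > 0" using K H \<kappa> N0 by (simp add: r_def)
  have NKr: "N * (K * r) \<le> 1/2"
  proof -
    have "N * (K * r) \<le> N * (K * (1 / (2 * K * (N + 1))))"
      using N0 K by (intro mult_left_mono) (auto simp: r_def)
    also have "\<dots> = N / (N + 1) / 2" using N0 K by simp
    also have "\<dots> \<le> 1/2" using N0 by simp
    finally show ?thesis .
  qed
  have NHr: "N * (r * H) \<le> \<kappa> / 4"
  proof -
    have "N * (r * H) \<le> N * (\<kappa> / (4 * H * (N + 1)) * H)"
      using N0 H by (intro mult_left_mono mult_right_mono) (auto simp: r_def)
    also have "\<dots> = N / (N + 1) * (\<kappa> / 4)" using N0 H by simp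
    also have "\<dots> \<le> 1 * (\<kappa> / 4)" using N0 \<kappa> by (intro mult_right_mono) auto
    also have "\<dots> = \<kappa> / 4" by simp
    finally show ?thesis .
  qed
  let ?W = "\<lambda>n. {w. set w \<subseteq> B \<and> length w = n}"
  define \<phi> where "\<phi> = (\<lambda>b z. h b z / p z)"
  define I where "I = (\<lambda>w. contour_integral (circlepath a \<epsilon>) (\<lambda>z. prod_list (map (\<lambda>b. \<phi> b z) w)))"
  \<comment> \<open>At the empty word the second summand is \<open>0\<close> because of the division by \<open>0\<close>, which
    matches the missing constant term of the logarithm series.\<close>
  define D where "D = (\<lambda>w. (if w = [] then Re a else 0)
      + Re ((-1) ^ length w / of_nat (length w) / (2 * of_real pi * \<i>) * I w))"
  have psph: "norm (p z) \<ge> 3/4 * \<kappa> * \<epsilon>" "p z \<noteq> 0" if "z \<in> sphere a \<epsilon>" for z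
  proof -
    show *: "norm (p z) \<ge> 3/4 * \<kappa> * \<epsilon>"
      using p_ge[of z] that by (simp add: dist_norm norm_minus_commute)
    have "0 < 3/4 * \<kappa> * \<epsilon>" using \<kappa> \<epsilon> by simp
    with * show "p z \<noteq> 0" by auto
  qed
  have \<phi>K: "norm (\<phi> b z) \<le> K" if "b \<in> B" "z \<in> sphere a \<epsilon>" for b z
    unfolding \<phi>_def K_def norm_divide using hH(1)[OF that(1), of z] psph[OF that(2)] that \<kappa> \<epsilon> H
    by (intro frac_le) auto
  have \<phi>cont: "continuous_on (sphere a \<epsilon>) (\<phi> b)" if "b \<in> B" for b
    unfolding \<phi>_def using \<epsilon> psph(2) that
    by (intro continuous_on_divide holomorphic_on_imp_continuous_on
        holomorphic_on_subset[OF h] holomorphic_on_subset[OF p]) auto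
  have prod_cont: "continuous_on (sphere a \<epsilon>) (\<lambda>z. prod_list (map (\<lambda>b. \<phi> b z) w))" if "set w \<subseteq> B" for w
    using that by (induction w) (auto intro!: continuous_intros \<phi>cont)
  have prod_int: "(\<lambda>z. prod_list (map (\<lambda>b. \<phi> b z) w)) contour_integrable_on circlepath a \<epsilon>" if "set w \<subseteq> B" for w
    using prod_cont[OF that] \<epsilon> by (intro contour_integrable_continuous_circlepath) simp
  have prod_bound: "norm (prod_list (map (\<lambda>b. \<phi> b z) w)) \<le> K ^ length w" if "set w \<subseteq> B" "z \<in> sphere a \<epsilon>" for w z
    using that(1)
  proof (induction w)
    case (Cons b w)
    have "norm (\<phi> b z) * norm (prod_list (map (\<lambda>b. \<phi> b z) w)) \<le> K * K ^ length w"
      using Cons \<phi>K that(2) K by (intro mult_mono) auto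
    then show ?case by (simp add: norm_mult)
  qed simp
  have I_bound: "norm (I w) \<le> K ^ length w * (2 * pi * \<epsilon>)" if "set w \<subseteq> B" for w
    unfolding I_def using has_contour_integral_integral[OF prod_int[OF that]] prod_bound[OF that] K \<epsilon>
    by (intro has_contour_integral_bound_circlepath) (auto simp: dist_norm norm_minus_commute)
  have D_bound: "\<bar>D w\<bar> \<le> (\<bar>Re a\<bar> + \<epsilon>) * K ^ length w" if "set w \<subseteq> B" for w
  proof (cases "w = []")
    case True
    then show ?thesis using \<epsilon> by (simp add: D_def)
  next
    case False
    then have n: "real (length w) \<ge> 1" by (cases w) auto
    have "\<bar>D w\<bar> \<le> norm ((-1) ^ length w / of_nat (length w) / (2 * of_real pi * \<i>) * I w)"
      using False abs_Re_le_cmod by (simp add: D_def)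
    also have "\<dots> = 1 / length w * (norm (I w) / (2 * pi))"
      by (simp add: norm_mult norm_divide norm_power)
    also have "\<dots> \<le> 1 * (K ^ length w * (2 * pi * \<epsilon>) / (2 * pi))"
    proof (intro mult_mono divide_right_mono)
      show "1 / real (length w) \<le> 1" using n by (subst divide_le_eq_1_pos) linarith+
    qed (use I_bound[OF that] in auto)
    also have "\<dots> \<le> (\<bar>Re a\<bar> + \<epsilon>) * K ^ length w"
      using K by (simp add: algebra_simps)
    finally show ?thesis .
  qed
  have NKr1: "real (card B) * (K * r) < 1" using NKr by (simp add: N_def)
  obtain c where c: "\<And>t s. (\<forall>b\<in>B. \<bar>t b\<bar> < r) \<Longrightarrow>
       (\<lambda>n. \<Sum>w\<in>?W n. D w * prod_list (map t w)) sums s \<Longrightarrow>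
       ((\<lambda>\<alpha>. c \<alpha> * (\<Prod>b\<in>B. t b ^ \<alpha> b)) has_sum s) (B \<rightarrow>\<^sub>E UNIV)"
    using word_series_imp_power_series[OF B D_bound less_imp_le[OF K] r NKr1] by blast
  show ?thesis
  proof (rule exI[of _ \<epsilon>], rule conjI[OF \<epsilon>(1)], rule exI[of _ r], rule conjI[OF r],
      rule exI[of _ c], intro allI impI)
    fix t :: "'b \<Rightarrow> real" and \<zeta>
    assume t: "\<forall>b\<in>B. \<bar>t b\<bar> < r" and \<zeta>: "\<zeta> \<in> ball a \<epsilon>"
      and z0: "p \<zeta> + (\<Sum>b\<in>B. of_real (t b) * h b \<zeta>) = 0"
    define u where "u = (\<lambda>z. \<Sum>b\<in>B. of_real (t b) * h b z)"
    have u: "u holomorphic_on ball a R" unfolding u_def by (intro holomorphic_intros h)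
    have lin: "norm (\<Sum>b\<in>B. of_real (t b) * g b) \<le> N * (r * M)"
      if "\<And>b. b \<in> B \<Longrightarrow> norm (g b) \<le> M" for g :: "'b \<Rightarrow> complex" and M
    proof -
      have "norm (\<Sum>b\<in>B. of_real (t b) * g b) \<le> (\<Sum>b\<in>B. r * M)"
      proof (rule sum_norm_le)
        fix b assume b: "b \<in> B"
        then have "\<bar>t b\<bar> \<le> r" using t by (auto intro: less_imp_le)
        then show "norm (of_real (t b) * g b) \<le> r * M"
          unfolding norm_mult norm_of_real using that[OF b] r by (intro mult_mono) auto
      qed
      then show ?thesis by (simp add: N_def)
    qed
    have du: "deriv u z = (\<Sum>b\<in>B. of_real (t b) * deriv (h b) z)" if "z \<in> cball a \<epsilon>" for z
      unfolding u_def using that sub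
      by (intro DERIV_imp_deriv DERIV_sum DERIV_cmult der h) auto
    have dF: "deriv (\<lambda>z. p z + u z) z = deriv p z + deriv u z" if "z \<in> cball a \<epsilon>" for z
      using that sub by (intro DERIV_imp_deriv derivative_intros der p u) auto
    have dF_close: "norm (deriv (\<lambda>z. p z + u z) z - deriv p a) \<le> \<kappa> / 2" if z: "z \<in> cball a \<epsilon>" for z
    proof -
      have "norm (deriv u z) \<le> \<kappa> / 4" unfolding du[OF z] 
        using lin[of "\<lambda>b. deriv (h b) z" H] hH(2)[OF _ z] NHr by fastforce
      moreover have "norm (deriv (\<lambda>z. p z + u z) z - deriv p a) \<le> norm (deriv p z - deriv p a) + norm (deriv u z)"
        unfolding dF[OF z] by (rule order_trans[OF _ norm_triangle_ineq]) (simp add: algebra_simps)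
      ultimately show ?thesis using \<epsilon>(3)[OF z] by linarith
    qed
    have Fz0: "p \<zeta> + u \<zeta> = 0" using z0 by (simp add: u_def)
    have \<zeta>c: "\<zeta> \<in> cball a \<epsilon>" using \<zeta> by auto
    have F_ge: "\<kappa> / 2 * norm (z - \<zeta>) \<le> norm (p z + u z)" if "z \<in> cball a \<epsilon>" for z
    proof -
      have "(norm (deriv p a) - \<kappa> / 2) * norm (z - \<zeta>) \<le> norm ((p z + u z) - (p \<zeta> + u \<zeta>))"
      proof (rule norm_diff_ge_of_deriv_close[OF _ convex_cball dF_close that \<zeta>c])
        fix w assume "w \<in> cball a \<epsilon>"
        then show "((\<lambda>z. p z + u z) has_field_derivative deriv (\<lambda>z. p z + u z) w) (at w)"
          using sub by (intro der holomorphic_intros p u) auto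
      qed
      then show ?thesis using Fz0 by (simp add: \<kappa>_def)
    qed
    have dFz: "deriv (\<lambda>z. p z + u z) \<zeta> \<noteq> 0"
      using dF_close[OF \<zeta>c] \<kappa> by (auto simp: \<kappa>_def)
    define q where "q = (\<lambda>z. \<Sum>b\<in>B. of_real (t b) * \<phi> b z)"
    have q: "u z / p z = q z" for z by (simp add: q_def u_def \<phi>_def sum_divide_distrib)
    have q_half: "norm (q z) \<le> 1/2" if "z \<in> sphere a \<epsilon>" for z
      unfolding q_def 
      using lin[of "\<lambda>b. \<phi> b z" K] \<phi>K[OF _ that] NKr by (fastforce simp: mult_ac)
    have Ln_int: "((\<lambda>z. Ln (1 + u z / p z)) has_contour_integral - (2 * of_real pi * \<i> * (\<zeta> - a))) (circlepath a \<epsilon>)"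
    proof (rule contour_integral_Ln_perturbation[OF p u \<epsilon>(1,2) a _ \<zeta> Fz0 dFz])
      show "p z \<noteq> 0" if "z \<in> cball a \<epsilon>" "z \<noteq> a" for z
      proof -
        have "0 < 3/4 * \<kappa> * norm (z - a)" using that \<kappa> by simp
        then show ?thesis using p_ge[OF that(1)] by auto
      qed
      show "p z + u z \<noteq> 0" if "z \<in> cball a \<epsilon>" "z \<noteq> \<zeta>" for z
      proof -
        have "0 < \<kappa> / 2 * norm (z - \<zeta>)" using that \<kappa> by simp
        then show ?thesis using F_ge[OF that(1)] by auto
      qed
      show "norm (u z) < norm (p z)" if "z \<in> sphere a \<epsilon>" for z
      proof -
        have "norm (u z) = norm (q z) * norm (p z)"
          using psph(2)[OF that] by (simp add: norm_divide flip: q)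
        also have "\<dots> \<le> 1/2 * norm (p z)" by (intro mult_right_mono q_half that) auto
        also have "\<dots> < norm (p z)" using psph(2)[OF that] by simp
        finally show ?thesis .
      qed
    qed
    define T where "T = (\<lambda>k z. (-1) ^ Suc k / of_nat k * q z ^ k)"
    define integ where "integ = (\<lambda>k. (-1) ^ Suc k / of_nat k * (\<Sum>w\<in>?W k. of_real (prod_list (map t w)) * I w))"
    have T_int: "(T k has_contour_integral integ k) (circlepath a \<epsilon>)" for k
    proof -
      have "prod_list (map (\<lambda>b. of_real (t b) * \<phi> b z) w) = of_real (prod_list (map t w)) * prod_list (map (\<lambda>b. \<phi> b z) w)" for w z
        by (induction w) auto
      then have "T k = (\<lambda>z. (-1) ^ Suc k / of_nat k * (\<Sum>w\<in>?W k. of_real (prod_list (map t w)) * prod_list (map (\<lambda>b. \<phi> b z) w)))"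
        by (simp add: T_def q_def power_sum_eq_sum_words[OF B])
      then show ?thesis unfolding integ_def I_def
        by (simp only:) (intro has_contour_integral_lmul has_contour_integral_sum
            finite_lists_length_eq[OF B] has_contour_integral_integral prod_int; auto)
    qed
    have "((\<lambda>n. contour_integral (circlepath a \<epsilon>) (\<lambda>z. \<Sum>k<n. T k z)) \<longlongrightarrow>
        contour_integral (circlepath a \<epsilon>) (\<lambda>z. \<Sum>k. T k z)) sequentially"
    proof (rule contour_integral_uniform_limit_circlepath[OF _ _ _ \<epsilon>(1)])
      show "\<forall>\<^sub>F n in sequentially. (\<lambda>z. \<Sum>k<n. T k z) contour_integrable_on circlepath a \<epsilon>"
        by (intro always_eventually allI contour_integrable_sum
            has_contour_integral_integrable[OF T_int]) auto
      show "uniform_limit (sphere a \<epsilon>) (\<lambda>n z. \<Sum>k<n. T k z) (\<lambda>z. \<Sum>k. T k z) sequentially"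
      proof (rule Weierstrass_m_test[where M = "\<lambda>k. (1/2) ^ k"])
        fix k z assume z: "z \<in> sphere a \<epsilon>"
        have "norm (T k z) = 1 / real k * norm (q z) ^ k"
          by (simp add: T_def norm_mult norm_divide norm_power)
        also have "\<dots> \<le> 1 * (1/2) ^ k"
          using q_half[OF z] by (intro mult_mono power_mono) (auto simp: divide_simps)
        finally show "norm (T k z) \<le> (1/2) ^ k" by simp
      qed (auto intro: summable_geometric)
    qed auto
    moreover have "contour_integral (circlepath a \<epsilon>) (\<lambda>z. \<Sum>k<n. T k z) = (\<Sum>k<n. integ k)" for n
      by (intro contour_integral_unique has_contour_integral_sum T_int) auto
    moreover have "contour_integral (circlepath a \<epsilon>) (\<lambda>z. \<Sum>k. T k z) = - (2 * of_real pi * \<i> * (\<zeta> - a))"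
    proof (rule contour_integral_unique, rule has_contour_integral_eq[OF Ln_int])
      fix z assume "z \<in> path_image (circlepath a \<epsilon>)"
      then have "norm (q z) < 1" using q_half[of z] \<epsilon> by simp
      then have "(\<lambda>k. T k z) sums Ln (1 + q z)" unfolding T_def by (rule Ln_series)
      then show "Ln (1 + u z / p z) = (\<Sum>k. T k z)" by (simp add: q sums_iff)
    qed
    ultimately have "integ sums - (2 * of_real pi * \<i> * (\<zeta> - a))" by (simp add: sums_def)
    from sums_mult[OF this, of "- 1 / (2 * of_real pi * \<i>)"]
    moreover have "- 1 / (2 * of_real pi * \<i>) * - (2 * of_real pi * \<i> * (\<zeta> - a)) = \<zeta> - a" by simp
    ultimately have "(\<lambda>k. - 1 / (2 * of_real pi * \<i>) * integ k) sums (\<zeta> - a)" by (simp only:)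
    from sums_Re[OF this] have "(\<lambda>k. Re (- 1 / (2 * of_real pi * \<i>) * integ k)) sums Re (\<zeta> - a)" .
    from sums_add[OF sums_single[of 0 "\<lambda>_. Re a"] this]
    have S: "(\<lambda>k. (if k = 0 then Re a else 0) + Re (- 1 / (2 * of_real pi * \<i>) * integ k)) sums Re \<zeta>" by simp
    have "(\<Sum>w\<in>?W k. D w * prod_list (map t w))
        = (if k = 0 then Re a else 0) + Re (- 1 / (2 * of_real pi * \<i>) * integ k)" for k
    proof (cases k)
      case 0
      have "?W 0 = {[]}" by auto
      then show ?thesis using 0 by (simp add: D_def integ_def)
    next
      case (Suc n)
      have "D w * prod_list (map t w)
          = Re ((-1) ^ k / of_nat k / (2 * of_real pi * \<i>) * (of_real (prod_list (map t w)) * I w))"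
        if "w \<in> ?W k" for w
      proof -
        have "D w = Re ((-1) ^ k / of_nat k / (2 * of_real pi * \<i>) * I w)" using that Suc by (auto simp: D_def)
        moreover have "Re (X * (of_real y * Z)) = Re (X * Z) * y" for X Z y
          by (simp add: algebra_simps)
        ultimately show ?thesis by (simp only:)
      qed
      then have "(\<Sum>w\<in>?W k. D w * prod_list (map t w))
          = Re ((-1) ^ k / of_nat k / (2 * of_real pi * \<i>) * (\<Sum>w\<in>?W k. of_real (prod_list (map t w)) * I w))"
        by (simp only: sum_distrib_left Re_sum cong: sum.cong)
      also have "(-1) ^ k / of_nat k / (2 * of_real pi * \<i>) * (\<Sum>w\<in>?W k. of_real (prod_list (map t w)) * I w)
          = - 1 / (2 * of_real pi * \<i>) * integ k" by (simp add: integ_def)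
      finally show ?thesis using Suc by simp
    qed
    with S have "(\<lambda>k. \<Sum>w\<in>?W k. D w * prod_list (map t w)) sums Re \<zeta>" by simp
    then show "((\<lambda>\<alpha>. c \<alpha> * (\<Prod>b\<in>B. t b ^ \<alpha> b)) has_sum Re \<zeta>) (B \<rightarrow>\<^sub>E UNIV)"
      by (rule c[OF t])
  qed
qed

section \<open>Analytic dependence on the frequencies\<close>

text \<open>The perturbation of the pressure by a change of frequencies is linear in that change.\<close>
lemma pressure_add_sum_scaleR:
  "pressure \<gamma> (x + (\<Sum>b\<in>B. t b *\<^sub>R b)) s = pressure \<gamma> x s + (\<Sum>b\<in>B. t b * pressure \<gamma> b s)"
proof -
  have "(\<Sum>b\<in>B. t b * pressure \<gamma> b s) = (\<Sum>i\<in>UNIV. \<Sum>b\<in>B. t b * (b $ i * ln (\<Sum>j. \<gamma> i j powr s)))"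
    unfolding pressure_def sum_distrib_left by (rule sum.swap)
  then show ?thesis
    by (simp add: pressure_def sum_component distrib_right sum.distrib sum_distrib_right mult.assoc)
qed

lemma rel_interior_contains_small_combinations:
  fixes T :: "'a::euclidean_space set"
  assumes "x \<in> rel_interior T" "finite B" "span B = (\<lambda>y. y - x) ` (affine hull rel_interior T)"
  shows "\<exists>r>0. \<forall>t. (\<forall>b\<in>B. \<bar>t b\<bar> < r) \<longrightarrow> x + (\<Sum>b\<in>B. t b *\<^sub>R b) \<in> rel_interior T"
proof -
  have "openin (top_of_set (affine hull T)) (rel_interior T)" by (rule openin_rel_interior)
  then obtain e where e: "e > 0" "ball x e \<inter> affine hull T \<subseteq> rel_interior T"
    using assms(1) by (auto simp: openin_contains_ball)
  define M where "M = 1 + (\<Sum>b\<in>B. norm b)"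
  have M: "M > 0" by (simp add: M_def add_pos_nonneg sum_nonneg)
  have "x + (\<Sum>b\<in>B. t b *\<^sub>R b) \<in> rel_interior T" if t: "\<forall>b\<in>B. \<bar>t b\<bar> < e / M" for t
  proof -
    let ?v = "\<Sum>b\<in>B. t b *\<^sub>R b"
    have "?v \<in> span B" by (intro span_sum span_scale span_base)
    then have "x + ?v \<in> affine hull rel_interior T" using assms(3) by auto
    then have "x + ?v \<in> affine hull T" using hull_mono[OF rel_interior_subset] by blast
    moreover have "norm ?v < e"
    proof -
      have "norm ?v \<le> (\<Sum>b\<in>B. e / M * norm b)"
      proof (rule sum_norm_le)
        fix b assume "b \<in> B"
        then have "\<bar>t b\<bar> \<le> e / M" using t by (auto intro: less_imp_le)
        then show "norm (t b *\<^sub>R b) \<le> e / M * norm b" unfolding norm_scaleR by (rule mult_right_mono) simp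
      qed
      also have "\<dots> = e / M * (M - 1)" by (simp add: M_def sum_distrib_left)
      also have "\<dots> < e" using e(1) M by (simp add: field_simps)
      finally show ?thesis .
    qed
    ultimately show ?thesis using e(2) by (auto simp: dist_norm)
  qed
  then show ?thesis using e(1) M by (intro exI[of _ "e / M"]) auto
qed

text \<open>
  The implicit function theorem describes the zeros within some \<open>\<epsilon>\<close> of \<open>\<Delta> x\<close>. That \<open>\<Delta> \<eta>\<close> is one of them
  for \<open>\<eta>\<close> near \<open>x\<close> follows from \<open>dist_pressure_zero_le\<close>, the pressure at \<open>\<Delta> x\<close> being of order \<open>\<eta> - x\<close>.
\<close>
theorem (in ratio_vectors) real_analytic_pressure_zero:
  fixes \<Delta> :: "real ^ 'm \<Rightarrow> real"
  assumes \<Delta>: "\<And>\<eta>. \<eta> \<in> open_simplex \<Longrightarrow> theta \<gamma> < \<Delta> \<eta> \<and> pressure \<gamma> \<eta> (\<Delta> \<eta>) = 0"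
  shows "real_analytic_on_relopen \<Delta> open_simplex"
  unfolding real_analytic_on_relopen_def
proof (intro ballI allI impI)
  fix x and B :: "(real ^ 'm) set"
  assume x: "x \<in> open_simplex" and B: "independent B \<and> span B = (\<lambda>y. y - x) ` (affine hull open_simplex)"
  then have fin: "finite B" by (simp add: independent_imp_finite)
  have simplex: "\<And>i. 0 \<le> \<eta> $ i" "(\<Sum>i\<in>UNIV. \<eta> $ i) = 1" if "\<eta> \<in> open_simplex" for \<eta> :: "real ^ 'm"
    using that rel_interior_subset by (fastforce simp: open_simplex_def)+
  note D = \<Delta>[OF x]
  obtain r1 where r1: "r1 > 0"
      "\<And>t. \<forall>b\<in>B. \<bar>t b\<bar> < r1 \<Longrightarrow> x + (\<Sum>b\<in>B. t b *\<^sub>R b) \<in> open_simplex"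
    using rel_interior_contains_small_combinations[of x _ B] x B fin unfolding open_simplex_def by blast
  obtain R where R: "R > 0" "\<And>v. complex_pressure v holomorphic_on ball (of_real (\<Delta> x)) R"
    using holomorphic_complex_pressure D by blast
  have 0: "complex_pressure x (of_real (\<Delta> x)) = 0" using D by (simp add: complex_pressure_of_real)
  have "deriv (complex_pressure x) (of_real (\<Delta> x)) \<noteq> 0"
    using D by (intro deriv_complex_pressure_neq_0 simplex[OF x]) auto
  from analytic_implicit_function[OF fin R(1) R(2) R(2) 0 this, of "\<lambda>b. b"]
  obtain \<epsilon> r2 :: real and c :: "(real ^ 'm \<Rightarrow> nat) \<Rightarrow> real" where \<epsilon>: "0 < \<epsilon>" "0 < r2"
    and c: "\<And>t \<zeta>. (\<forall>b\<in>B. \<bar>t b\<bar> < r2) \<Longrightarrow> \<zeta> \<in> ball (of_real (\<Delta> x)) \<epsilon> \<Longrightarrow>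
        complex_pressure x \<zeta> + (\<Sum>b\<in>B. of_real (t b) * complex_pressure b \<zeta>) = 0 \<Longrightarrow>
       ((\<lambda>\<alpha>. c \<alpha> * (\<Prod>b\<in>B. t b ^ \<alpha> b)) has_sum Re \<zeta>) (B \<rightarrow>\<^sub>E UNIV)"
    by (elim exE conjE) blast
  define M where "M = 1 + (\<Sum>b\<in>B. \<bar>pressure \<gamma> b (\<Delta> x)\<bar>)"
  have M: "M > 0" by (simp add: M_def add_pos_nonneg sum_nonneg)
  define r where "r = min (min r1 r2) (\<epsilon> * (- ln q) / M)"
  have "0 < \<epsilon> * (- ln q) / M" using \<epsilon> M ln_q_neg by (intro divide_pos_pos mult_pos_pos) auto
  then have "r > 0" using r1 \<epsilon> by (simp add: r_def)
  moreover have "x + (\<Sum>b\<in>B. t b *\<^sub>R b) \<in> open_simplex \<and>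
      ((\<lambda>\<alpha>. c \<alpha> * (\<Prod>b\<in>B. t b ^ \<alpha> b)) has_sum \<Delta> (x + (\<Sum>b\<in>B. t b *\<^sub>R b))) (B \<rightarrow>\<^sub>E UNIV)"
    if t: "\<forall>b\<in>B. \<bar>t b\<bar> < r" for t
  proof -
    let ?\<eta> = "x + (\<Sum>b\<in>B. t b *\<^sub>R b)"
    have t12: "\<forall>b\<in>B. \<bar>t b\<bar> < r1" "\<forall>b\<in>B. \<bar>t b\<bar> < r2" using t by (auto simp: r_def)
    have \<eta>: "?\<eta> \<in> open_simplex" by (rule r1(2)[OF t12(1)])
    note D\<eta> = \<Delta>[OF \<eta>]
    have "\<bar>\<Delta> ?\<eta> - \<Delta> x\<bar> * (- ln q) \<le> \<bar>pressure \<gamma> ?\<eta> (\<Delta> x)\<bar>"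
      using D D\<eta> by (intro dist_pressure_zero_le simplex[OF \<eta>]) auto
    also have "pressure \<gamma> ?\<eta> (\<Delta> x) = (\<Sum>b\<in>B. t b * pressure \<gamma> b (\<Delta> x))"
      using D by (simp add: pressure_add_sum_scaleR)
    also have "\<bar>\<dots>\<bar> \<le> (\<Sum>b\<in>B. r * \<bar>pressure \<gamma> b (\<Delta> x)\<bar>)"
    proof (rule order_trans[OF sum_abs sum_mono])
      fix b assume "b \<in> B"
      then have "\<bar>t b\<bar> \<le> r" using t by (auto intro: less_imp_le)
      then show "\<bar>t b * pressure \<gamma> b (\<Delta> x)\<bar> \<le> r * \<bar>pressure \<gamma> b (\<Delta> x)\<bar>"
        unfolding abs_mult by (rule mult_right_mono) simp
    qed
    also have "\<dots> = r * (M - 1)" by (simp add: M_def sum_distrib_left)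
    also have "\<dots> < r * M" using \<open>r > 0\<close> by simp
    also have "\<dots> \<le> \<epsilon> * (- ln q) / M * M" using M by (intro mult_right_mono) (auto simp: r_def)
    also have "\<dots> = \<epsilon> * (- ln q)" using M by simp
    finally have "\<bar>\<Delta> ?\<eta> - \<Delta> x\<bar> < \<epsilon>" using ln_q_neg by simp
    then have "complex_of_real (\<Delta> ?\<eta>) \<in> ball (of_real (\<Delta> x)) \<epsilon>"
      by (simp add: dist_norm norm_minus_commute flip: of_real_diff)
    moreover have "complex_pressure x (of_real (\<Delta> ?\<eta>)) + (\<Sum>b\<in>B. of_real (t b) * complex_pressure b (of_real (\<Delta> ?\<eta>))) = 0"
    proof -
      have "pressure \<gamma> x (\<Delta> ?\<eta>) + (\<Sum>b\<in>B. t b * pressure \<gamma> b (\<Delta> ?\<eta>)) = 0"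
        using D\<eta> by (simp add: pressure_add_sum_scaleR)
      from arg_cong[OF this, of complex_of_real] show ?thesis
        using D\<eta> by (simp add: complex_pressure_of_real)
    qed
    ultimately show ?thesis using c[OF t12(2)] \<eta> by fastforce
  qed
  ultimately show "\<exists>c r. 0 < r \<and> (\<forall>t. (\<forall>b\<in>B. \<bar>t b\<bar> < r) \<longrightarrow>
      x + (\<Sum>b\<in>B. t b *\<^sub>R b) \<in> open_simplex \<and>
      ((\<lambda>\<alpha>. c \<alpha> * (\<Prod>b\<in>B. t b ^ \<alpha> b)) has_sum \<Delta> (x + (\<Sum>b\<in>B. t b *\<^sub>R b))) (B \<rightarrow>\<^sub>E UNIV))"
    by blast
qed

lemma real_analytic_on_relopen_transform:
  assumes "real_analytic_on_relopen g S" and eq: "\<And>x. x \<in> S \<Longrightarrow> f x = g x"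
  shows "real_analytic_on_relopen f S"
  unfolding real_analytic_on_relopen_def
proof (intro ballI allI impI)
  fix x B assume "x \<in> S" "independent B \<and> span B = (\<lambda>y. y - x) ` (affine hull S)"
  from assms(1)[unfolded real_analytic_on_relopen_def, rule_format, OF this]
  obtain c r where "r > 0" "\<forall>t. (\<forall>b\<in>B. \<bar>t b\<bar> < r) \<longrightarrow> x + (\<Sum>b\<in>B. t b *\<^sub>R b) \<in> S \<and>
         ((\<lambda>\<alpha>. c \<alpha> * (\<Prod>b\<in>B. t b ^ \<alpha> b)) has_sum g (x + (\<Sum>b\<in>B. t b *\<^sub>R b))) (B \<rightarrow>\<^sub>E UNIV)"
    by blast
  then show "\<exists>c r. r > 0 \<and> (\<forall>t. (\<forall>b\<in>B. \<bar>t b\<bar> < r) \<longrightarrow> x + (\<Sum>b\<in>B. t b *\<^sub>R b) \<in> S \<and>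
         ((\<lambda>\<alpha>. c \<alpha> * (\<Prod>b\<in>B. t b ^ \<alpha> b)) has_sum f (x + (\<Sum>b\<in>B. t b *\<^sub>R b))) (B \<rightarrow>\<^sub>E UNIV))"
    using eq by (intro exI[of _ c] exI[of _ r]) auto
qed

theorem theorem3p10:
  fixes a :: "'m::finite \<Rightarrow> nat"
    and \<gamma> :: "'m \<Rightarrow> nat \<Rightarrow> real"
    and J :: "(real ^ 'd::finite) set"
    and \<omega> :: "real ^ 'm \<Rightarrow> nat \<Rightarrow> nat"
    and E :: "real ^ 'm \<Rightarrow> (real ^ 'd) set"
  assumes "inj a" and "\<And>i. a i > 0"
    and "\<And>i j. \<gamma> i j > 0"
    and "\<And>i. summable (\<gamma> i)"
    and "Sup {\<gamma> i j | i j. True} < 1"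
    and "\<exists>i. \<not> summable (\<lambda>j. \<gamma> i j powr theta \<gamma>)"
    and "\<And>\<eta>. \<eta> \<in> open_simplex \<Longrightarrow> \<exists>u > theta \<gamma>. pressure \<gamma> \<eta> u > 0"
    and "J \<noteq> {}" and "compact J" and "J = closure (interior J)" and "diameter J = 1"
    and "\<And>\<eta>. \<eta> \<in> open_simplex \<Longrightarrow> \<omega> \<eta> \<in> freq_seqs a \<eta>"
    and "\<And>\<eta>. \<eta> \<in> open_simplex \<Longrightarrow> moran_fractal a \<gamma> J (\<omega> \<eta>) (E \<eta>)"
  shows "real_analytic_on_relopen (\<lambda>\<eta>. enn2real (hausdorff_dim (E \<eta>))) open_simplex"
proof -
  \<comment> \<open>The supremum of an unbounded set of reals carries no information, so boundedness of the
    ratios has to come from summability.\<close>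
  have le_total: "\<gamma> i j \<le> (\<Sum>i\<in>UNIV. suminf (\<gamma> i))" for i j
  proof -
    have "\<gamma> i j \<le> suminf (\<gamma> i)"
      using sum_le_suminf[OF assms(4), of "{j}" i] assms(3) by (simp add: less_imp_le)
    also have "\<dots> \<le> (\<Sum>i\<in>UNIV. suminf (\<gamma> i))"
      using assms(3,4) by (intro member_le_sum suminf_nonneg) (auto intro: less_imp_le)
    finally show ?thesis .
  qed
  interpret ratio_vectors \<gamma> "Sup {\<gamma> i j | i j. True}"
  proof
    show "\<gamma> i j \<le> Sup {\<gamma> i j | i j. True}" for i j
      using le_total by (intro cSup_upper bdd_aboveI) auto
  qed (use assms in auto)
  have simplex: "\<And>i. 0 \<le> \<eta> $ i" "(\<Sum>i\<in>UNIV. \<eta> $ i) = 1" if "\<eta> \<in> open_simplex" for \<eta> :: "real ^ 'm"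
    using that rel_interior_subset by (fastforce simp: open_simplex_def)+
  define \<Delta> where "\<Delta> = (\<lambda>\<eta>. SOME D. theta \<gamma> < D \<and> pressure \<gamma> \<eta> D = 0)"
  have \<Delta>: "theta \<gamma> < \<Delta> \<eta> \<and> pressure \<gamma> \<eta> (\<Delta> \<eta>) = 0" if \<eta>: "\<eta> \<in> open_simplex" for \<eta>
  proof -
    obtain u where "theta \<gamma> < u" "0 < pressure \<gamma> \<eta> u" using assms(7)[OF \<eta>] by blast
    from pressure_zero_exists[where \<eta> = \<eta>, OF simplex[OF \<eta>] this]
    show ?thesis unfolding \<Delta>_def by (rule someI_ex)
  qed
  have "interior J \<noteq> {}" using assms(8,10) by auto
  then have dim: "hausdorff_dim (E \<eta>) = ennreal (\<Delta> \<eta>)" if "\<eta> \<in> open_simplex" for \<eta>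
    using \<Delta>[OF that] simplex[OF that] assms(1,9,11) assms(12,13)[OF that]
    by (intro hausdorff_dim_moran_fractal[of a "\<omega> \<eta>" \<eta> J]) auto
  show ?thesis
  proof (rule real_analytic_on_relopen_transform[OF real_analytic_pressure_zero[OF \<Delta>]])
    show "enn2real (hausdorff_dim (E \<eta>)) = \<Delta> \<eta>" if "\<eta> \<in> open_simplex" for \<eta>
      using dim[OF that] \<Delta>[OF that] theta_nonneg by simp
  qed
qed

end
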